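(* Assume that $\mathbb{P}^{\alpha,y}(T_A<\infty)=1$ for all $y\in S_Y$, and that $\alpha>0$ and $\beta>\lambda^o$. Then $Y=(N,\Lambda)$ has invariant measure $\Pi$ on $(\mathbb{N}\cup\{0\})\times[\lambda^o,A)$ given by $\Pi(n,d\lambda)=\pi(n,\lambda)\,d\lambda$, $n\ge0$, with density $$\pi(0,\lambda)=\mathbf{1}_{\{\lambda<\beta\}}\frac{K_0}{\alpha(\beta-\lambda^o)}\left(\frac{\beta-\lambda}{\beta-\lambda^o}\right)^{\frac{\beta-\alpha}{\alpha}}e^{\frac{\lambda-\lambda^o}{\alpha}},$$ and, for $n\ge1$, $$\pi(n,\lambda)=\mathbf{1}_{\{\lambda<\beta\}}\frac{1}{F(\lambda)}\int_{\lambda^o}^{\lambda}\frac{F(y)\,p(n-1,y)}{\alpha(\beta-y)}\,dy+\mathbf{1}_{\{\lambda\ge\beta\}}\frac{1}{F(\lambda)}\int_{\lambda}^{A}\frac{F(y)\,p(n-1,y)}{\alpha(y-\beta)}\,dy,$$ where, for $n\ge0$, $$p(n,\lambda)=\int\mathbf{1}_{\{u+\lambda^o<\lambda\}}(\lambda-u)\,\pi(n,\lambda-u)\,dG_\ell(n+1,u),\qquad F(\lambda)=\exp\!\left(-\frac{\lambda}{\alpha}\right)|\lambda-\beta|^{\frac{\alpha-\beta}{\alpha}},$$ and $K_0=\sum_{n=1}^\infty\int_{[\lambda^o,A)}\lambda\,\bar G_\ell(n,(A-\lambda)-)\,\Pi(n-1,d\lambda)$.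
   Context: Constants: $\alpha\ge 0$, $\beta>0$, $A\in(\beta,\infty)$, $\lambda^o\in(0,\beta]$. $(Z_i)_{i\ge1}$ are i.i.d. $[0,\infty)$-valued random variables with distribution function $G$ and finite second moment. $\ell(n,z)$ ($n\ge1$, $z\ge0$) is a strictly positive function such that, for each $n$, $z\mapsto\ell(n,z)$ is non-decreasing and continuous. $G_\ell(n,\cdot)$ is the distribution function of $\ell(n,Z_n)$; $\bar G_\ell:=1-G_\ell$, and $\bar G_\ell(n,a-)$ is the left limit at $a$, i.e. the probability that $\ell(n,Z_n)\ge a$. $Y=(N,\Lambda)$ is the (first two components of the) self-exciting piecewise-deterministic Markov process with resetting: the right-continuous Markov process on $S_Y=(\mathbb{N}\cup\{0\})\times[\lambda^o,A)$ such that between jumps $d\Lambda_t=\alpha(\beta-\Lambda_t)dt$ and $N$ is constant; jumps occur at rate $\Lambda$; at a jump, with mark $Z$ freshly drawn from $G$, $(N,\Lambda)$ moves from $(n,\lambda)$ to $(n+1,\lambda+\ell(n+1,Z))$ if $\lambda+\ell(n+1,Z)<A$, and to $(0,\lambda^o)$ (a reset) otherwise. $T_A$ is the time of the first reset. $\mathbb{P}^{\alpha,y}$ is the law when $Y_0=y$. A measure on $S_Y$ is written $\Pi(n,d\lambda)$, and it is invariant if it is preserved by the transition semigroup of $Y$. The invariant measure is determined up to a multiplicative scaling (so that $K_0$ is fixed by the choice of scaling). *)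

theory Defs
  imports "HOL-Probability.Probability"
begin

section \<open>Paths of the process\<close>

text \<open>
  Conventions used throughout: \<open>lo\<close> is the reset level $\lambda^o$; \<open>G\<close> is the law of the
  marks, a probability measure on the Borel sets of $[0,\infty)$; \<open>ell n z\<close> is $\ell(n,z)$,
  of which only the values with \<open>n \<ge> 1\<close> and \<open>z \<ge> 0\<close> are ever used.  Points of the state space
  are pairs \<open>(n, l)\<close>.
\<close>

definition state_space :: "real \<Rightarrow> real \<Rightarrow> (nat \<times> real) measure" where
  "state_space lo A = count_space UNIV \<Otimes>\<^sub>M restrict_space borel {lo..<A}"

text \<open>The solution of $d\Lambda_t=\alpha(\beta-\Lambda_t)\,dt$ started at \<open>l\<close>.\<close>

definition flow :: "real \<Rightarrow> real \<Rightarrow> real \<Rightarrow> real \<Rightarrow> real" where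
  "flow \<alpha> \<beta> l t = \<beta> + (l - \<beta>) * exp (- \<alpha> * t)"

lemma flow_0: "flow \<alpha> \<beta> l 0 = l"
  by (simp add: flow_def)

lemma flow_ode: "(flow \<alpha> \<beta> l has_real_derivative \<alpha> * (\<beta> - flow \<alpha> \<beta> l t)) (at t)"
  unfolding flow_def by (auto intro!: derivative_eq_intros)

text \<open>
  If \<open>e\<close> is exponentially distributed with mean one, then \<open>holding \<alpha> \<beta> l e\<close> is the first event
  time of a point process with intensity \<open>flow \<alpha> \<beta> l\<close>; see \<open>prob_holding_gt\<close> below.
\<close>

definition holding :: "real \<Rightarrow> real \<Rightarrow> real \<Rightarrow> real \<Rightarrow> real" where
  "holding \<alpha> \<beta> l e = Inf {t. 0 \<le> t \<and> e \<le> integral {0..t} (flow \<alpha> \<beta> l)}"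

definition jump :: "real \<Rightarrow> real \<Rightarrow> (nat \<Rightarrow> real \<Rightarrow> real) \<Rightarrow> nat \<times> real \<Rightarrow> real \<Rightarrow> nat \<times> real" where
  "jump A lo ell y z =
     (if snd y + ell (fst y + 1) z < A then (fst y + 1, snd y + ell (fst y + 1) z) else (0, lo))"

text \<open>
  A sample point is a stream \<open>\<omega>\<close> of pairs: \<open>fst (\<omega> !! k)\<close> determines the holding time before
  the jump number \<open>k + 1\<close>, and \<open>snd (\<omega> !! k)\<close> is the mark drawn at this jump.
\<close>

definition driving :: "real measure \<Rightarrow> (real \<times> real) stream measure" where
  "driving G = stream_space (density lborel (exponential_density 1) \<Otimes>\<^sub>M G)"

text \<open>
  \<open>skeleton \<dots> y \<omega> k\<close> is the time of the \<open>k\<close>-th jump (zero if \<open>k = 0\<close>) together with the state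
  right after it; \<open>pre_jump \<dots> y \<omega> k\<close> is the state right before the jump number \<open>k + 1\<close>.
\<close>

primrec skeleton :: "real \<Rightarrow> real \<Rightarrow> real \<Rightarrow> real \<Rightarrow> (nat \<Rightarrow> real \<Rightarrow> real) \<Rightarrow>
    nat \<times> real \<Rightarrow> (real \<times> real) stream \<Rightarrow> nat \<Rightarrow> real \<times> (nat \<times> real)" where
  "skeleton \<alpha> \<beta> A lo ell y \<omega> 0 = (0, y)"
| "skeleton \<alpha> \<beta> A lo ell y \<omega> (Suc k) =
     (case skeleton \<alpha> \<beta> A lo ell y \<omega> k of (T, n, l) \<Rightarrow>
        let \<tau> = holding \<alpha> \<beta> l (fst (\<omega> !! k))
        in (T + \<tau>, jump A lo ell (n, flow \<alpha> \<beta> l \<tau>) (snd (\<omega> !! k))))"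

definition pre_jump :: "real \<Rightarrow> real \<Rightarrow> real \<Rightarrow> real \<Rightarrow> (nat \<Rightarrow> real \<Rightarrow> real) \<Rightarrow>
    nat \<times> real \<Rightarrow> (real \<times> real) stream \<Rightarrow> nat \<Rightarrow> nat \<times> real" where
  "pre_jump \<alpha> \<beta> A lo ell y \<omega> k =
     (case skeleton \<alpha> \<beta> A lo ell y \<omega> k of (T, n, l) \<Rightarrow>
        (n, flow \<alpha> \<beta> l (holding \<alpha> \<beta> l (fst (\<omega> !! k)))))"

text \<open>
  The right-continuous path started at \<open>y\<close>.  Intensities stay below \<open>A\<close>, so almost surely the
  jump times increase to infinity and the \<open>LEAST\<close> below exists.
\<close>

definition path :: "real \<Rightarrow> real \<Rightarrow> real \<Rightarrow> real \<Rightarrow> (nat \<Rightarrow> real \<Rightarrow> real) \<Rightarrow>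
    nat \<times> real \<Rightarrow> (real \<times> real) stream \<Rightarrow> real \<Rightarrow> nat \<times> real" where
  "path \<alpha> \<beta> A lo ell y \<omega> t =
     (let k = (LEAST k. t < fst (skeleton \<alpha> \<beta> A lo ell y \<omega> (Suc k)))
      in case skeleton \<alpha> \<beta> A lo ell y \<omega> k of (T, n, l) \<Rightarrow> (n, flow \<alpha> \<beta> l (t - T)))"

text \<open>The time $T_A$ of the first reset; it is infinite if there is none.\<close>

definition reset_time :: "real \<Rightarrow> real \<Rightarrow> real \<Rightarrow> real \<Rightarrow> (nat \<Rightarrow> real \<Rightarrow> real) \<Rightarrow>
    nat \<times> real \<Rightarrow> (real \<times> real) stream \<Rightarrow> ereal" where
  "reset_time \<alpha> \<beta> A lo ell y \<omega> =
     (INF k\<in>{k. case pre_jump \<alpha> \<beta> A lo ell y \<omega> k of (n, l) \<Rightarrow>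
                  A \<le> l + ell (n + 1) (snd (\<omega> !! k))}.
        ereal (fst (skeleton \<alpha> \<beta> A lo ell y \<omega> (Suc k))))"


section \<open>Transition semigroup and invariance\<close>

definition transition :: "real \<Rightarrow> real \<Rightarrow> real \<Rightarrow> real \<Rightarrow> real measure \<Rightarrow> (nat \<Rightarrow> real \<Rightarrow> real) \<Rightarrow>
    real \<Rightarrow> nat \<times> real \<Rightarrow> (nat \<times> real) measure" where
  "transition \<alpha> \<beta> A lo G ell t y =
     distr (driving G) (state_space lo A) (\<lambda>\<omega>. path \<alpha> \<beta> A lo ell y \<omega> t)"

definition invariant_measure :: "'a measure \<Rightarrow> (real \<Rightarrow> 'a \<Rightarrow> 'a measure) \<Rightarrow> 'a measure \<Rightarrow> bool" where
  "invariant_measure S P M \<longleftrightarrow>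
     sets M = sets S \<and>
     (\<forall>t\<ge>0. \<forall>B\<in>sets S. (\<integral>\<^sup>+ y. emeasure (P t y) B \<partial>M) = emeasure M B)"


section \<open>The invariant density\<close>

text \<open>\<open>jump_law G ell n\<close> is the law of $\ell(n,Z_n)$, so that its \<open>cdf\<close> is $G_\ell(n,\cdot)$;
  \<open>jump_tail_left G ell n a\<close> is $\bar G_\ell(n,a-)$.\<close>

definition jump_law :: "real measure \<Rightarrow> (nat \<Rightarrow> real \<Rightarrow> real) \<Rightarrow> nat \<Rightarrow> real measure" where
  "jump_law G ell n = distr G borel (ell n)"

definition jump_tail_left :: "real measure \<Rightarrow> (nat \<Rightarrow> real \<Rightarrow> real) \<Rightarrow> nat \<Rightarrow> real \<Rightarrow> real" where
  "jump_tail_left G ell n a = Lim (at_left a) (\<lambda>x. 1 - cdf (jump_law G ell n) x)"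

text \<open>
  At \<open>l = \<beta>\<close> the library conventions give \<open>integrating_factor \<alpha> \<beta> \<beta> = 0\<close> and
  \<open>1 / integrating_factor \<alpha> \<beta> \<beta> = 0\<close>, so the densities below vanish at this single point if
  \<open>n \<ge> 1\<close>; it is null for Lebesgue measure.
\<close>

definition integrating_factor :: "real \<Rightarrow> real \<Rightarrow> real \<Rightarrow> real" where
  "integrating_factor \<alpha> \<beta> l = exp (- l / \<alpha>) * \<bar>l - \<beta>\<bar> powr ((\<alpha> - \<beta>) / \<alpha>)"

text \<open>$p(n,\lambda)$, as a functional of $f=\pi(n,\cdot)$.\<close>

definition inflow :: "real \<Rightarrow> real measure \<Rightarrow> (nat \<Rightarrow> real \<Rightarrow> real) \<Rightarrow>
    nat \<Rightarrow> (real \<Rightarrow> ennreal) \<Rightarrow> real \<Rightarrow> ennreal" where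
  "inflow lo G ell n f l =
     (\<integral>\<^sup>+ u. indicator {u. u + lo < l} u * ennreal (l - u) * f (l - u) \<partial>jump_law G ell (n + 1))"

text \<open>Densities are extended nonnegative reals because the integral defining $p(n,\lambda)$ may
  diverge at exceptional $\lambda$.\<close>

primrec inv_density :: "real \<Rightarrow> real \<Rightarrow> real \<Rightarrow> real \<Rightarrow> real measure \<Rightarrow> (nat \<Rightarrow> real \<Rightarrow> real) \<Rightarrow>
    real \<Rightarrow> nat \<Rightarrow> real \<Rightarrow> ennreal" where
  "inv_density \<alpha> \<beta> A lo G ell K0 0 = (\<lambda>l.
     if l < \<beta> then
       ennreal (K0 / (\<alpha> * (\<beta> - lo)) * ((\<beta> - l) / (\<beta> - lo)) powr ((\<beta> - \<alpha>) / \<alpha>)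
                * exp ((l - lo) / \<alpha>))
     else 0)"
| "inv_density \<alpha> \<beta> A lo G ell K0 (Suc n) = (\<lambda>l.
     if l < \<beta> then
       ennreal (1 / integrating_factor \<alpha> \<beta> l) *
       (\<integral>\<^sup>+ y\<in>{lo..l}. ennreal (integrating_factor \<alpha> \<beta> y / (\<alpha> * (\<beta> - y)))
           * inflow lo G ell n (inv_density \<alpha> \<beta> A lo G ell K0 n) y \<partial>lborel)
     else
       ennreal (1 / integrating_factor \<alpha> \<beta> l) *
       (\<integral>\<^sup>+ y\<in>{l..A}. ennreal (integrating_factor \<alpha> \<beta> y / (\<alpha> * (y - \<beta>)))
           * inflow lo G ell n (inv_density \<alpha> \<beta> A lo G ell K0 n) y \<partial>lborel))"

text \<open>The measure $\Pi$ and its slices $\Pi(n,d\lambda)$.\<close>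

definition inv_measure :: "real \<Rightarrow> real \<Rightarrow> real \<Rightarrow> real \<Rightarrow> real measure \<Rightarrow> (nat \<Rightarrow> real \<Rightarrow> real) \<Rightarrow>
    real \<Rightarrow> (nat \<times> real) measure" where
  "inv_measure \<alpha> \<beta> A lo G ell K0 =
     density (count_space UNIV \<Otimes>\<^sub>M restrict_space lborel {lo..<A})
       (\<lambda>(n, l). inv_density \<alpha> \<beta> A lo G ell K0 n l)"

definition inv_slice :: "real \<Rightarrow> real \<Rightarrow> real \<Rightarrow> real \<Rightarrow> real measure \<Rightarrow> (nat \<Rightarrow> real \<Rightarrow> real) \<Rightarrow>
    real \<Rightarrow> nat \<Rightarrow> real measure" where
  "inv_slice \<alpha> \<beta> A lo G ell K0 n =
     density (restrict_space lborel {lo..<A}) (inv_density \<alpha> \<beta> A lo G ell K0 n)"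


section \<open>Sanity checks for the definitions\<close>

lemma flow_between:
  assumes "0 \<le> \<alpha>" "0 \<le> t"
  shows "min l \<beta> \<le> flow \<alpha> \<beta> l t" "flow \<alpha> \<beta> l t \<le> max l \<beta>"
proof -
  define c where "c = exp (- \<alpha> * t)"
  have c: "0 \<le> c" "c \<le> 1" using assms by (simp_all add: c_def)
  have e: "flow \<alpha> \<beta> l t = c * l + (1 - c) * \<beta>"
    by (simp add: flow_def c_def algebra_simps)
  have "c * min l \<beta> + (1 - c) * min l \<beta> \<le> c * l + (1 - c) * \<beta>"
    using c by (intro add_mono mult_left_mono) auto
  then show "min l \<beta> \<le> flow \<alpha> \<beta> l t" by (simp add: e algebra_simps)
  have "c * l + (1 - c) * \<beta> \<le> c * max l \<beta> + (1 - c) * max l \<beta>"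
    using c by (intro add_mono mult_left_mono) auto
  then show "flow \<alpha> \<beta> l t \<le> max l \<beta>" by (simp add: e algebra_simps)
qed

lemma flow_integrable: "flow \<alpha> \<beta> l integrable_on {a..b}"
  by (intro integrable_continuous_real continuous_at_imp_continuous_on ballI
        DERIV_isCont[OF flow_ode])

lemma hazard_increment:
  assumes "0 \<le> \<alpha>" "0 \<le> s" "s \<le> t"
  shows "integral {0..t} (flow \<alpha> \<beta> l) - integral {0..s} (flow \<alpha> \<beta> l) \<le> (t - s) * max l \<beta>"
    and "(t - s) * min l \<beta> \<le> integral {0..t} (flow \<alpha> \<beta> l) - integral {0..s} (flow \<alpha> \<beta> l)"
proof -
  have eq: "integral {0..s} (flow \<alpha> \<beta> l) + integral {s..t} (flow \<alpha> \<beta> l) =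
      integral {0..t} (flow \<alpha> \<beta> l)"
    using assms by (intro Henstock_Kurzweil_Integration.integral_combine flow_integrable) auto
  have "integral {s..t} (flow \<alpha> \<beta> l) \<le> integral {s..t} (\<lambda>_. max l \<beta>)"
    using assms by (intro integral_le flow_integrable flow_between integrable_const_ivl) auto
  with eq show "integral {0..t} (flow \<alpha> \<beta> l) - integral {0..s} (flow \<alpha> \<beta> l) \<le> (t - s) * max l \<beta>"
    using assms by simp
  have "integral {s..t} (\<lambda>_. min l \<beta>) \<le> integral {s..t} (flow \<alpha> \<beta> l)"
    using assms by (intro integral_le flow_integrable flow_between integrable_const_ivl) auto
  with eq show "(t - s) * min l \<beta> \<le> integral {0..t} (flow \<alpha> \<beta> l) - integral {0..s} (flow \<alpha> \<beta> l)"
    using assms by simp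
qed

lemma holding_gt_iff:
  assumes "0 \<le> \<alpha>" "0 < \<beta>" "0 < l" "0 \<le> t"
  shows "t < holding \<alpha> \<beta> l e \<longleftrightarrow> integral {0..t} (flow \<alpha> \<beta> l) < e"
proof -
  let ?H = "\<lambda>t. integral {0..t} (flow \<alpha> \<beta> l)"
  let ?S = "{t. 0 \<le> t \<and> e \<le> ?H t}"
  have bdd: "bdd_below ?S" by (rule bdd_belowI[of _ 0]) auto
  have mono: "?H s \<le> ?H t" if "0 \<le> s" "s \<le> t" for s t
  proof -
    have "0 \<le> (t - s) * min l \<beta>" using that assms by (intro mult_nonneg_nonneg) auto
    with hazard_increment(2)[OF assms(1) that, of l \<beta>] show ?thesis by linarith
  qed
  show ?thesis
  proof
    assume *: "t < holding \<alpha> \<beta> l e"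
    show "?H t < e"
    proof (rule ccontr)
      assume "\<not> ?H t < e"
      then have "t \<in> ?S" using assms by auto
      from cInf_lower[OF this bdd] * show False by (simp add: holding_def)
    qed
  next
    assume *: "?H t < e"
    define t' where "t' = t + (e - ?H t) / (2 * max l \<beta>)"
    have m: "0 < max l \<beta>" "0 < min l \<beta>" using assms by auto
    have t': "t < t'" using * m by (simp add: t'_def)
    have "?H t' - ?H t \<le> (t' - t) * max l \<beta>"
      using hazard_increment(1)[OF assms(1,4), of t' \<beta> l] t' by simp
    also have "\<dots> = (e - ?H t) / 2" using m by (simp add: t'_def)
    finally have lt: "?H t' < e" using * by argo
    define r where "r = \<bar>e\<bar> / min l \<beta>"
    have r: "0 \<le> r" using m by (simp add: r_def)
    have "e \<le> ?H r"
      using hazard_increment(2)[OF assms(1) order_refl r, of l \<beta>] m by (simp add: r_def)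
    with r have "r \<in> ?S" by simp
    moreover have "t' \<le> s" if "s \<in> ?S" for s
      using mono[of s t'] that lt by force
    ultimately have "t' \<le> Inf ?S" by (intro cInf_greatest) auto
    with t' show "t < holding \<alpha> \<beta> l e" by (simp add: holding_def)
  qed
qed

text \<open>Jumps occur at rate $\Lambda$.\<close>

lemma prob_holding_gt:
  assumes "0 \<le> \<alpha>" "0 < \<beta>" "0 < l" "0 \<le> t"
  shows "measure (density lborel (exponential_density 1)) {e. t < holding \<alpha> \<beta> l e} =
    exp (- integral {0..t} (flow \<alpha> \<beta> l))"
proof -
  let ?E = "density lborel (exponential_density 1)"
  interpret E: prob_space ?E by (rule prob_space_exponential_density) simp
  have "distributed ?E lborel (\<lambda>x. x) (exponential_density 1)"
    by (auto simp: distributed_def intro!: distr_id2)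
  moreover have "0 \<le> integral {0..t} (flow \<alpha> \<beta> l)"
    using hazard_increment(2)[OF assms(1) order_refl assms(4), of l \<beta>] assms
    by (auto intro: order_trans[of _ "t * min l \<beta>"])
  ultimately have "E.prob {x \<in> space ?E. integral {0..t} (flow \<alpha> \<beta> l) < x} =
      exp (- integral {0..t} (flow \<alpha> \<beta> l) * 1)"
    by (intro E.exponential_distributedD_gt) auto
  then show ?thesis using assms by (simp add: holding_gt_iff)
qed

lemma jump_tail_left_eq:
  assumes "prob_space G" "ell n \<in> borel_measurable G"
  shows "jump_tail_left G ell n a = measure G {z \<in> space G. a \<le> ell n z}"
proof -
  interpret G: prob_space G by fact
  interpret J: real_distribution "jump_law G ell n"
    unfolding jump_law_def using assms(2) by (rule G.real_distribution_distr)
  have "((\<lambda>x. 1 - cdf (jump_law G ell n) x) \<longlongrightarrow> 1 - measure (jump_law G ell n) {..<a}) (at_left a)"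
    by (intro tendsto_intros J.cdf_at_left)
  then have "jump_tail_left G ell n a = 1 - measure (jump_law G ell n) {..<a}"
    unfolding jump_tail_left_def by (intro tendsto_Lim) auto
  also have "\<dots> = measure (jump_law G ell n) {a..}"
    using J.prob_compl[of "{..<a}"] by (simp add: jump_law_def Compl_eq_Diff_UNIV[symmetric])
  also have "\<dots> = measure G {z \<in> space G. a \<le> ell n z}"
    using assms(2) by (auto simp: jump_law_def measure_distr intro!: arg_cong[where f="measure G"])
  finally show ?thesis .
qed

end

theory Submission
  imports Defs
begin

text \<open>
  A reset brings the process back to \<open>(0, lo)\<close>, so an invariant measure is given by the expected
  occupation time of one cycle from \<open>(0, lo)\<close> to the first reset.  Since \<open>N\<close> counts the jumps since
  the last reset, the part of this measure on \<open>{n} \<times> [lo, A)\<close> is the occupation time of the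
  deterministic flow started from the law of the state after the \<open>n\<close>-th jump; if $\Pi(n, \cdot)$ has
  density $\pi(n, \cdot)$, then the next post-jump law has density $p(n, \cdot)$, and the
  substitution of the position for the time along the flow turns it into $\pi(n + 1, \cdot)$.

  Invariance comes from a renewal argument: with \<open>\<tau>\<close> the first jump time,
  $\int_0^\tau f(Y_{s+t})\,ds + \int_0^t f(Y_s)\,ds = \int_0^\tau f(Y_s)\,ds + \int_\tau^{\tau+t} f(Y_s)\,ds$,
  whose expectations telescope over the jumps of a cycle, because cycles end almost surely.
  The second claim says that the probabilities of a reset at the \<open>n\<close>-th jump of a cycle add up to one.
\<close>

text \<open>All identities live in \<open>ennreal\<close>, since the occupation measure of a cycle
  may be infinite; they are therefore stated as sums on both sides. The only term ever cancelled is
  the finite-horizon one, and it is finite because a test function bounded by one accumulates at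
  most \<open>t\<close> in time \<open>t\<close>. Laws of states are carried as functionals on test
  functions, so that conditioning on jumps becomes composition of operators. The function
  \<open>F\<close> comes from the balance of mass along the flow without inflow, (\<alpha>(\<beta> -
  x) g(x))' = - x g(x), which \<open>1 / F\<close> solves on each side of \<beta>. The point \<beta>
  is the obstacle to the change of variable: the flow rests there, so its occupation time is an
  atom. It does no harm because a cycle starts at \<open>lo < \<beta>\<close> and every later
  post-jump law has a Lebesgue density. From any other point the flow approaches \<beta>
  monotonically without reaching it, which is why the density has one formula on each side. The
  constant \<open>K0\<close> is the weight given to one cycle.\<close>

section \<open>Change of variable and interchange of integrals on half-lines\<close>

lemma SUP_mult_indicator_incseq:
  fixes c :: ennreal
  assumes "incseq A"
  shows "(SUP n::nat. c * indicator (A n) x) = c * indicator (\<Union>n. A n) x"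
proof -
  have "(SUP n. c * indicator (A n) x) = c * (SUP n. indicator (A n) x)"
    by (simp add: SUP_mult_left_ennreal)
  also have "(SUP n. indicator (A n) x :: ennreal) = indicator (\<Union>n. A n) x"
    using LIMSEQ_indicator_incseq[OF assms, of x, where 'a=ennreal]
    by (intro LIMSEQ_unique[OF LIMSEQ_SUP])
       (use assms in \<open>auto simp: incseq_def le_fun_def indicator_def\<close>)
  finally show ?thesis .
qed

text \<open>Substitution on the compact intervals \<open>{0..real (Suc n)}\<close>, nondegenerate
  thanks to \<open>Suc\<close>, followed by monotone convergence. The image stays a union because
  \<open>g\<close> is used both with an unbounded range (the cumulative intensity) and with a finite
  limit that is not attained (the approach to \<beta>); each use computes the union itself.\<close>

lemma nn_integral_substitution_halfline:
  fixes f :: "real \<Rightarrow> ennreal" and g g' :: "real \<Rightarrow> real"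
  assumes [measurable]: "f \<in> borel_measurable borel"
    and deriv: "\<And>x. (g has_real_derivative g' x) (at x)"
    and cont: "continuous_on UNIV g'"
    and nonneg: "\<And>x. 0 \<le> x \<Longrightarrow> 0 \<le> g' x"
  shows "(\<integral>\<^sup>+s. f (g s) * ennreal (g' s) * indicator {0..} s \<partial>lborel) =
         (\<integral>\<^sup>+x. f x * indicator (\<Union>n::nat. {g 0..g (real (Suc n))}) x \<partial>lborel)"
proof -
  have "continuous_on UNIV g"
    using deriv by (intro continuous_at_imp_continuous_on ballI DERIV_isCont) auto
  then have [measurable]: "g \<in> borel_measurable borel"
    by (rule borel_measurable_continuous_onI)
  have [measurable]: "g' \<in> borel_measurable borel"
    using cont by (rule borel_measurable_continuous_onI)
  have mono: "g x \<le> g y" if "0 \<le> x" "x \<le> y" for x y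
    using that by (intro DERIV_nonneg_imp_nondecreasing[OF that(2)]) (use deriv nonneg in force)
  have inc1: "incseq (\<lambda>n. {g 0..g (real (Suc n))})"
    by (intro incseq_SucI) (auto intro: order_trans mono)
  have inc2: "incseq (\<lambda>n. {0..real (Suc n)})"
    by (intro incseq_SucI) auto
  have un: "(\<Union>n. {0..real (Suc n)}) = {0..}"
  proof (intro equalityI subsetI)
    fix x :: real assume x: "x \<in> {0..}"
    obtain n where "x \<le> real n" using real_arch_simple by blast
    with x show "x \<in> (\<Union>n. {0..real (Suc n)})" by (intro UN_I[of n]) auto
  qed auto
  have mc: "(\<integral>\<^sup>+x. h x * indicator (\<Union>n. A n) x \<partial>lborel) = (SUP n. \<integral>\<^sup>+x. h x * indicator (A n) x \<partial>lborel)"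
    if [measurable]: "h \<in> borel_measurable borel" "\<And>n. A n \<in> sets borel" and "incseq A"
    for h :: "real \<Rightarrow> ennreal" and A :: "nat \<Rightarrow> real set"
  proof -
    have "(\<integral>\<^sup>+x. h x * indicator (\<Union>n. A n) x \<partial>lborel) =
        (\<integral>\<^sup>+x. (SUP n. h x * indicator (A n) x) \<partial>lborel)"
      by (simp only: SUP_mult_indicator_incseq[OF that(3)])
    also have "\<dots> = (SUP n. \<integral>\<^sup>+x. h x * indicator (A n) x \<partial>lborel)"
    proof (rule nn_integral_monotone_convergence_SUP)
      show "incseq (\<lambda>n x. h x * indicator (A n) x)"
        using that(3) by (auto simp: incseq_def le_fun_def indicator_def subset_iff)
    qed measurable
    finally show ?thesis .
  qed
  have "(\<integral>\<^sup>+s. f (g s) * ennreal (g' s) * indicator {0..} s \<partial>lborel) =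
      (SUP n. \<integral>\<^sup>+s. f (g s) * ennreal (g' s) * indicator {0..real (Suc n)} s \<partial>lborel)"
    unfolding un[symmetric] by (intro mc inc2) auto
  also have "\<dots> = (SUP n. \<integral>\<^sup>+x. f x * indicator {g 0..g (real (Suc n))} x \<partial>lborel)"
    by (intro SUP_cong refl nn_integral_substitution_aux[symmetric] deriv continuous_on_subset[OF cont] nonneg) auto
  also have "\<dots> = (\<integral>\<^sup>+x. f x * indicator (\<Union>n::nat. {g 0..g (real (Suc n))}) x \<partial>lborel)"
    by (intro mc[symmetric] inc1) auto
  finally show ?thesis .
qed

text \<open>Many integration ranges below have endpoints that are integration variables of an outer
  integral; this rule and the next give the joint measurability that Fubini asks for.\<close>

lemma borel_measurable_indicator_Icc [measurable (raw)]:
  fixes f g h :: "'a \<Rightarrow> real"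
  assumes [measurable]: "f \<in> borel_measurable M" "g \<in> borel_measurable M" "h \<in> borel_measurable M"
  shows "(\<lambda>x. indicator {f x..g x} (h x) :: ennreal) \<in> borel_measurable M"
  unfolding indicator_def atLeastAtMost_iff by measurable

lemma borel_measurable_indicator_Ici [measurable (raw)]:
  fixes f h :: "'a \<Rightarrow> real"
  assumes [measurable]: "f \<in> borel_measurable M" "h \<in> borel_measurable M"
  shows "(\<lambda>x. indicator {f x..} (h x) :: ennreal) \<in> borel_measurable M"
  unfolding indicator_def atLeast_iff by measurable

text \<open>The two terms on the left cover, in the coordinates $(r, v)$, the parts $r + v > t$ and
  $r + v \<le> t$ of the strip $0 \<le> v \<le> t$, $r \<ge> 0$.\<close>

lemma nn_integral_strip_split:
  fixes a :: "real \<Rightarrow> real \<Rightarrow> ennreal"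
  assumes [measurable]: "case_prod a \<in> borel_measurable (borel \<Otimes>\<^sub>M borel)" and "0 \<le> t"
  shows "(\<integral>\<^sup>+s\<in>{0..}. (\<integral>\<^sup>+r\<in>{0..t}. a (s + r) (t - r) \<partial>lborel) \<partial>lborel) +
      (\<integral>\<^sup>+s\<in>{0..t}. (\<integral>\<^sup>+r\<in>{0..s}. a r (s - r) \<partial>lborel) \<partial>lborel) =
      (\<integral>\<^sup>+v\<in>{0..t}. (\<integral>\<^sup>+r\<in>{0..}. a r v \<partial>lborel) \<partial>lborel)"
proof -
  have m[measurable (raw)]: "(\<lambda>x. a (f x) (g x)) \<in> borel_measurable M"
    if [measurable]: "f \<in> borel_measurable M" "g \<in> borel_measurable M" for f g and M :: "'b measure"
  proof -
    have "(\<lambda>x. case_prod a (f x, g x)) \<in> borel_measurable M" by measurable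
    then show ?thesis by simp
  qed
  have "(\<integral>\<^sup>+s\<in>{0..}. (\<integral>\<^sup>+r\<in>{0..t}. a (s + r) (t - r) \<partial>lborel) \<partial>lborel) =
     (\<integral>\<^sup>+s. (\<integral>\<^sup>+r. a (s + r) (t - r) * indicator {0..} s * indicator {0..t} r \<partial>lborel) \<partial>lborel)"
    by (intro nn_integral_cong) (auto simp: indicator_def)
  also have "\<dots> = (\<integral>\<^sup>+r. (\<integral>\<^sup>+s. a (s + r) (t - r) * indicator {0..} s * indicator {0..t} r \<partial>lborel) \<partial>lborel)"
    by (rule lborel_pair.Fubini') measurable
  also have "\<dots> = (\<integral>\<^sup>+r. (\<integral>\<^sup>+s. a s (t - r) * indicator {r..} s * indicator {0..t} r \<partial>lborel) \<partial>lborel)"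
  proof (rule nn_integral_cong)
    fix r :: real
    show "(\<integral>\<^sup>+s. a (s + r) (t - r) * indicator {0..} s * indicator {0..t} r \<partial>lborel) =
       (\<integral>\<^sup>+s. a s (t - r) * indicator {r..} s * indicator {0..t} r \<partial>lborel)"
      by (subst (2) nn_integral_real_affine[where c=1 and t=r])
         (auto intro!: nn_integral_cong simp: indicator_def add.commute)
  qed
  \<comment> \<open>The reflection \<open>v = t - r\<close>: the remaining time after the jump
    becomes the coordinate.\<close>
  also have "\<dots> = (\<integral>\<^sup>+v. (\<integral>\<^sup>+s. a s v * indicator {t - v..} s * indicator {0..t} v \<partial>lborel) \<partial>lborel)"
    by (subst nn_integral_real_affine[where c="-1" and t=t])
       (auto intro!: nn_integral_cong simp: indicator_def)
  finally have 1: "(\<integral>\<^sup>+s\<in>{0..}. (\<integral>\<^sup>+r\<in>{0..t}. a (s + r) (t - r) \<partial>lborel) \<partial>lborel) =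
    (\<integral>\<^sup>+v. (\<integral>\<^sup>+s. a s v * indicator {t - v..} s * indicator {0..t} v \<partial>lborel) \<partial>lborel)" .
  have "(\<integral>\<^sup>+s\<in>{0..t}. (\<integral>\<^sup>+r\<in>{0..s}. a r (s - r) \<partial>lborel) \<partial>lborel) =
     (\<integral>\<^sup>+s. (\<integral>\<^sup>+r. a r (s - r) * indicator {0..s} r * indicator {0..t} s \<partial>lborel) \<partial>lborel)"
    by (intro nn_integral_cong) (auto simp: indicator_def)
  also have "\<dots> = (\<integral>\<^sup>+r. (\<integral>\<^sup>+s. a r (s - r) * indicator {0..s} r * indicator {0..t} s \<partial>lborel) \<partial>lborel)"
    by (rule lborel_pair.Fubini') measurable
  also have "\<dots> = (\<integral>\<^sup>+r. (\<integral>\<^sup>+v. a r v * indicator {0..t} v * indicator {0..t - v} r \<partial>lborel) \<partial>lborel)"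
  proof (rule nn_integral_cong)
    fix r :: real
    show "(\<integral>\<^sup>+s. a r (s - r) * indicator {0..s} r * indicator {0..t} s \<partial>lborel) =
       (\<integral>\<^sup>+v. a r v * indicator {0..t} v * indicator {0..t - v} r \<partial>lborel)"
      by (subst nn_integral_real_affine[where c=1 and t=r])
         (auto intro!: nn_integral_cong simp: indicator_def)
  qed
  also have "\<dots> = (\<integral>\<^sup>+v. (\<integral>\<^sup>+r. a r v * indicator {0..t} v * indicator {0..t - v} r \<partial>lborel) \<partial>lborel)"
    by (rule lborel_pair.Fubini'[symmetric]) measurable
  finally have 2: "(\<integral>\<^sup>+s\<in>{0..t}. (\<integral>\<^sup>+r\<in>{0..s}. a r (s - r) \<partial>lborel) \<partial>lborel) =
     (\<integral>\<^sup>+v. (\<integral>\<^sup>+r. a r v * indicator {0..t} v * indicator {0..t - v} r \<partial>lborel) \<partial>lborel)" .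
  have "(\<integral>\<^sup>+r. a r v * indicator {t - v..} r * indicator {0..t} v \<partial>lborel) +
      (\<integral>\<^sup>+r. a r v * indicator {0..t} v * indicator {0..t - v} r \<partial>lborel) =
      (\<integral>\<^sup>+r\<in>{0..}. a r v \<partial>lborel) * indicator {0..t} v" for v
  proof -
    have "(\<integral>\<^sup>+r. a r v * indicator {t - v..} r * indicator {0..t} v \<partial>lborel) +
      (\<integral>\<^sup>+r. a r v * indicator {0..t} v * indicator {0..t - v} r \<partial>lborel) =
      (\<integral>\<^sup>+r. a r v * indicator {t - v..} r * indicator {0..t} v + a r v * indicator {0..t} v * indicator {0..t - v} r \<partial>lborel)"
      by (rule nn_integral_add[symmetric]) measurable
    \<comment> \<open>The two ranges for \<open>r\<close> overlap only in \<open>t - v\<close>,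
      which is a null set.\<close>
    also have "\<dots> = (\<integral>\<^sup>+r. a r v * indicator {0..} r * indicator {0..t} v \<partial>lborel)"
    proof (rule nn_integral_cong_AE)
      show "AE r in lborel. a r v * indicator {t - v..} r * indicator {0..t} v +
          a r v * indicator {0..t} v * indicator {0..t - v} r =
          a r v * indicator {0..} r * indicator {0..t} v"
        using AE_lborel_singleton[of "t - v"] by eventually_elim (auto simp: indicator_def)
    qed
    also have "\<dots> = (\<integral>\<^sup>+r\<in>{0..}. a r v \<partial>lborel) * indicator {0..t} v"
      by (rule nn_integral_multc) measurable
    finally show ?thesis .
  qed
  note v = this
  show ?thesis
    unfolding 1 2 by (simp only: v[symmetric], rule nn_integral_add[symmetric]) measurable
qed

section \<open>The standing assumptions and the measurable structure of the state space\<close>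

locale reset_process =
  fixes \<alpha> \<beta> A lo :: real and G :: "real measure" and ell :: "nat \<Rightarrow> real \<Rightarrow> real"
  assumes \<alpha>: "0 < \<alpha>" and \<beta>: "0 < \<beta>" "\<beta> < A" and lo: "0 < lo" "lo < \<beta>"
    and prob_G: "prob_space G"
    and sets_G: "sets G = sets (restrict_space borel {0..})"
    and ell_pos: "\<And>n z. 1 \<le> n \<Longrightarrow> 0 \<le> z \<Longrightarrow> 0 < ell n z"
    and ell_cont: "\<And>n. 1 \<le> n \<Longrightarrow> continuous_on {0..} (ell n)"
begin

abbreviation "S \<equiv> state_space lo A"
abbreviation "E \<equiv> density lborel (exponential_density 1) :: real measure"
abbreviation "\<Omega> \<equiv> driving G"
abbreviation "hold \<equiv> holding \<alpha> \<beta>"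
abbreviation "jmp \<equiv> jump A lo ell"

sublocale G: prob_space G by (rule prob_G)
sublocale E: prob_space E by (rule prob_space_exponential_density) simp
sublocale EG: pair_prob_space E G ..
sublocale \<Omega>: prob_space \<Omega> unfolding driving_def by (rule EG.P.prob_space_stream_space)

lemma space_G: "space G = {0..}"
  using sets_eq_imp_space_eq[OF sets_G] by (simp add: space_restrict_space)

lemma space_S: "y \<in> space S \<longleftrightarrow> lo \<le> snd y \<and> snd y < A"
  by (cases y) (auto simp: state_space_def space_pair_measure space_restrict_space)

lemma reset_state_in_S [simp, measurable]: "(0, lo) \<in> space S"
  using \<beta> lo by (simp add: space_S)

lemma snd_S_pos: "y \<in> space S \<Longrightarrow> 0 < snd y"
  using lo by (auto simp: space_S)

lemma measurable_fst_S [measurable]: "fst \<in> S \<rightarrow>\<^sub>M count_space UNIV"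
  unfolding state_space_def by measurable

lemma measurable_snd_S [measurable]: "snd \<in> borel_measurable S"
  unfolding state_space_def
  by (rule measurable_compose[OF measurable_snd]) (simp add: measurable_restrict_space1)

lemma measurable_Pair_S:
  assumes "h \<in> M \<rightarrow>\<^sub>M count_space UNIV" "k \<in> borel_measurable M"
    and "\<And>x. x \<in> space M \<Longrightarrow> (h x, k x) \<in> space S"
  shows "(\<lambda>x. (h x, k x)) \<in> M \<rightarrow>\<^sub>M S"
  unfolding state_space_def using assms
  by (intro measurable_Pair measurable_restrict_space2) (auto simp: space_S)

lemma ell_measurable [measurable]: "ell (Suc n) \<in> borel_measurable G"
  using borel_measurable_continuous_on_restrict[OF ell_cont[of "Suc n"]]
  by (simp add: measurable_cong_sets[OF sets_G refl])

section \<open>The flow and the holding times\<close>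

text \<open>The cumulative jump intensity, that is the integral of
  \<open>flow \<alpha> \<beta> l\<close> over \<open>{0..t}\<close>, in closed form. The formula
  also makes sense for negative \<open>t\<close>, so it is differentiable on the whole line, as the
  substitution lemma wants.\<close>

definition hazard :: "real \<Rightarrow> real \<Rightarrow> real" where
  "hazard l t = \<beta> * t + (l - \<beta>) * (1 - exp (- \<alpha> * t)) / \<alpha>"

definition survival :: "real \<Rightarrow> real \<Rightarrow> real" where
  "survival l t = exp (- hazard l t)"

lemma hazard_deriv: "(hazard l has_real_derivative flow \<alpha> \<beta> l t) (at t)"
  unfolding hazard_def flow_def using \<alpha> by (auto intro!: derivative_eq_intros)

lemma hazard_0 [simp]: "hazard l 0 = 0"
  by (simp add: hazard_def)

lemma integral_flow: "0 \<le> t \<Longrightarrow> integral {0..t} (flow \<alpha> \<beta> l) = hazard l t"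
  using fundamental_theorem_of_calculus[of 0 t "hazard l" "flow \<alpha> \<beta> l"] hazard_deriv[of l]
  by (intro integral_unique)
     (simp add: has_real_derivative_iff_has_vector_derivative has_vector_derivative_at_within)

lemma flow_add: "flow \<alpha> \<beta> l (s + t) = flow \<alpha> \<beta> (flow \<alpha> \<beta> l s) t"
  by (simp add: flow_def exp_add[symmetric] algebra_simps)

text \<open>The cumulative intensity is additive along the flow; this is the lack of memory of the
  holding times.\<close>

lemma survival_add: "survival l (s + t) = survival l s * survival (flow \<alpha> \<beta> l s) t"
proof -
  have "hazard l (s + t) = hazard l s + hazard (flow \<alpha> \<beta> l s) t"
    using \<alpha> by (simp add: hazard_def flow_def field_simps exp_add[symmetric])
  then show ?thesis by (simp add: survival_def exp_add[symmetric])
qed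

lemma survival_nonneg [simp]: "0 \<le> survival l t"
  by (simp add: survival_def)

text \<open>Run backwards, the flow leaves \<open>[lo, A)\<close>. Truncating the time at zero makes
  this a map into the state space for every real \<open>t\<close>, so measurability needs no side
  condition on the sign.\<close>

definition flow_state :: "nat \<times> real \<Rightarrow> real \<Rightarrow> nat \<times> real" where
  "flow_state y t = (fst y, flow \<alpha> \<beta> (snd y) (max 0 t))"

lemma flow_state_in_S: "y \<in> space S \<Longrightarrow> flow_state y t \<in> space S"
  using flow_between[where \<alpha>=\<alpha> and t="max 0 t" and l="snd y" and \<beta>=\<beta>] \<alpha> \<beta> lo by (auto simp: space_S flow_state_def)

lemma flow_pos: "y \<in> space S \<Longrightarrow> 0 \<le> t \<Longrightarrow> 0 < flow \<alpha> \<beta> (snd y) t"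
  using snd_S_pos[OF flow_state_in_S, of y t] by (simp add: flow_state_def)

lemma flow_state_add: "0 \<le> s \<Longrightarrow> 0 \<le> t \<Longrightarrow> flow_state y (s + t) = flow_state (flow_state y s) t"
  by (simp add: flow_state_def flow_add)

lemma snd_flow_state: "0 \<le> t \<Longrightarrow> snd (flow_state y t) = flow \<alpha> \<beta> (snd y) t"
  by (simp add: flow_state_def)

lemma flow_state_measurable [measurable (raw)]:
  assumes [measurable]: "f \<in> M \<rightarrow>\<^sub>M S" "g \<in> borel_measurable M"
  shows "(\<lambda>x. flow_state (f x) (g x)) \<in> M \<rightarrow>\<^sub>M S"
  unfolding flow_state_def
proof (rule measurable_Pair_S)
  show "(\<lambda>x. flow \<alpha> \<beta> (snd (f x)) (max 0 (g x))) \<in> borel_measurable M"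
    unfolding flow_def by measurable
next
  fix x assume "x \<in> space M"
  with flow_state_in_S[of "f x" "g x"] measurable_space[OF assms(1)]
  show "(fst (f x), flow \<alpha> \<beta> (snd (f x)) (max 0 (g x))) \<in> space S"
    by (simp add: flow_state_def)
qed measurable

lemma survival_measurable [measurable (raw)]:
  assumes [measurable]: "f \<in> borel_measurable M" "g \<in> borel_measurable M"
  shows "(\<lambda>x. survival (f x) (g x)) \<in> borel_measurable M"
  unfolding survival_def hazard_def by measurable

lemma hold_gt_iff: "0 < l \<Longrightarrow> 0 \<le> t \<Longrightarrow> t < hold l e \<longleftrightarrow> hazard l t < e"
  using holding_gt_iff[of \<alpha> \<beta> l t e] \<alpha> \<beta> by (simp add: integral_flow)

lemma hazard_lower: "0 \<le> t \<Longrightarrow> t * min l \<beta> \<le> hazard l t"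
  using hazard_increment(2)[of \<alpha> 0 t l \<beta>] \<alpha> by (simp add: integral_flow)

lemma hazard_upper: "0 \<le> t \<Longrightarrow> hazard l t \<le> t * max l \<beta>"
  using hazard_increment(1)[where s=0 and t=t and l=l and \<beta>=\<beta> and \<alpha>=\<alpha>] \<alpha> by (simp add: integral_flow)

lemma hazard_strict_mono: "0 < l \<Longrightarrow> 0 \<le> s \<Longrightarrow> s < t \<Longrightarrow> hazard l s < hazard l t"
proof -
  assume *: "0 < l" "0 \<le> s" "s < t"
  have "0 < (t - s) * min l \<beta>" using * \<beta> by (intro mult_pos_pos) auto
  with hazard_increment(2)[of \<alpha> s t l \<beta>] \<alpha> * show ?thesis by (simp add: integral_flow)
qed

lemma hold_nonneg: "0 < l \<Longrightarrow> 0 \<le> hold l e"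
proof -
  assume l: "0 < l"
  \<comment> \<open>The intensity is at least \<open>min l \<beta>\<close>, so the level
    \<open>e\<close> is reached by time \<open>r\<close>; the set in the definition of
    \<open>holding\<close> is thus nonempty.\<close>
  define r where "r = \<bar>e\<bar> / min l \<beta>"
  have r: "0 \<le> r" "r * min l \<beta> = \<bar>e\<bar>" using l \<beta> by (simp_all add: r_def)
  with hazard_lower[of r l] have "e \<le> integral {0..r} (flow \<alpha> \<beta> l)" by (simp add: integral_flow)
  with r(1) show ?thesis unfolding holding_def by (intro cInf_greatest) auto
qed

text \<open>By strict monotonicity of \<open>hazard l\<close>, both sides exceed exactly the same
  times \<open>t \<ge> 0\<close>. This one-sided inverse is all that the substitution
  \<open>e = hazard l s\<close> needs.\<close>

lemma hold_hazard: "0 < l \<Longrightarrow> 0 \<le> s \<Longrightarrow> hold l (hazard l s) = s"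
proof (rule ccontr)
  assume l: "0 < l" "0 \<le> s" and ne: "hold l (hazard l s) \<noteq> s"
  have iff: "t < hold l (hazard l s) \<longleftrightarrow> t < s" if "0 \<le> t" for t
    using hold_gt_iff[OF l(1) that, of "hazard l s"] hazard_strict_mono[OF l(1)] l(2) that
    by (metis less_le_not_le linorder_less_linear)
  from ne iff[OF l(2)] have "hold l (hazard l s) < s" by auto
  with iff[OF hold_nonneg[OF l(1)]] show False by auto
qed

text \<open>An infimum over uncountably many times is not visibly measurable, but by
  \<open>hold_gt_iff\<close> each superlevel set is a comparison with the explicit function
  \<open>hazard\<close>.\<close>

lemma hold_measurable [measurable (raw)]:
  assumes [measurable]: "f \<in> M \<rightarrow>\<^sub>M S" "g \<in> borel_measurable M"
  shows "(\<lambda>x. hold (snd (f x)) (g x)) \<in> borel_measurable M"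
proof (rule borel_measurable_iff_greater[THEN iffD2], rule allI)
  have pos: "0 < snd (f x)" if "x \<in> space M" for x
    using measurable_space[OF assms(1) that] by (rule snd_S_pos)
  fix a :: real
  show "{x \<in> space M. a < hold (snd (f x)) (g x)} \<in> sets M"
  proof (cases "0 \<le> a")
    case True
    then have "{x \<in> space M. a < hold (snd (f x)) (g x)} = {x \<in> space M. hazard (snd (f x)) a < g x}"
      using pos by (auto simp: hold_gt_iff)
    then show ?thesis unfolding hazard_def by simp
  next
    case False
    then have "{x \<in> space M. a < hold (snd (f x)) (g x)} = space M"
      using pos hold_nonneg by (auto simp: not_le intro: less_le_trans)
    then show ?thesis by simp
  qed
qed

lemma jump_in_S: "y \<in> space S \<Longrightarrow> 0 \<le> z \<Longrightarrow> jmp y z \<in> space S"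
  using \<beta> lo ell_pos[of "fst y + 1" z] by (auto simp: jump_def space_S)

lemma ell_measurable_raw [measurable (raw)]:
  assumes [measurable]: "f \<in> M \<rightarrow>\<^sub>M count_space UNIV" "g \<in> M \<rightarrow>\<^sub>M G"
  shows "(\<lambda>x. ell (Suc (f x)) (g x)) \<in> borel_measurable M"
  by (rule measurable_compose_countable[of "\<lambda>n x. ell (Suc n) (g x)"]) measurable

lemma jump_measurable [measurable (raw)]:
  assumes [measurable]: "f \<in> M \<rightarrow>\<^sub>M S" "g \<in> M \<rightarrow>\<^sub>M G"
  shows "(\<lambda>x. jmp (f x) (g x)) \<in> M \<rightarrow>\<^sub>M S"
proof -
  have *: "(\<lambda>x. (fst (jmp (f x) (g x)), snd (jmp (f x) (g x)))) \<in> M \<rightarrow>\<^sub>M S"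
  proof (rule measurable_Pair_S)
    show "(\<lambda>x. fst (jmp (f x) (g x))) \<in> M \<rightarrow>\<^sub>M count_space UNIV"
      unfolding jump_def by (simp add: if_distrib[of fst] cong: if_cong)
    show "(\<lambda>x. snd (jmp (f x) (g x))) \<in> borel_measurable M"
      unfolding jump_def by (simp add: if_distrib[of snd] cong: if_cong)
    show "(fst (jmp (f x) (g x)), snd (jmp (f x) (g x))) \<in> space S" if "x \<in> space M" for x
      using measurable_space[OF assms(1) that] measurable_space[OF assms(2) that]
      by (simp add: jump_in_S space_G)
  qed
  then show ?thesis by simp
qed

text \<open>Substituting \<open>e = hazard l s\<close> in the unit exponential law gives the first
  jump time the density intensity times survival.\<close>

lemma nn_integral_hold:
  assumes y: "y \<in> space S" and [measurable]: "g \<in> borel_measurable borel"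
  shows "(\<integral>\<^sup>+e. g (hold (snd y) e) \<partial>E) =
    (\<integral>\<^sup>+s\<in>{0..}. ennreal (snd (flow_state y s) * survival (snd y) s) * g s \<partial>lborel)"
proof -
  define l where "l = snd y"
  have l: "0 < l" using snd_S_pos[OF y] by (simp add: l_def)
  have [measurable]: "hold l \<in> borel_measurable borel"
    unfolding l_def using y by measurable
  \<comment> \<open>The cumulative intensity grows at least linearly, with slope
    \<open>min l \<beta>\<close>, so it covers the whole half-line.\<close>
  have cov: "(\<Union>n::nat. {hazard l 0..hazard l (real (Suc n))}) = {0..}"
  proof (intro equalityI subsetI)
    fix x :: real assume x: "x \<in> {0..}"
    obtain n where n: "x / min l \<beta> \<le> real n" using real_arch_simple by blast
    have "x \<le> real n * min l \<beta>" using n l \<beta> by (simp add: field_simps)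
    also have "\<dots> \<le> real (Suc n) * min l \<beta>" using l \<beta> by (intro mult_right_mono) auto
    also have "\<dots> \<le> hazard l (real (Suc n))" by (rule hazard_lower) simp
    finally show "x \<in> (\<Union>n::nat. {hazard l 0..hazard l (real (Suc n))})"
      using x by (intro UN_I[of n]) auto
  qed auto
  have "(\<integral>\<^sup>+e. g (hold l e) \<partial>E) = (\<integral>\<^sup>+e. (g (hold l e) * ennreal (exp (- e))) * indicator {0..} e \<partial>lborel)"
    by (subst nn_integral_density)
       (auto simp: exponential_density_def indicator_def mult.commute intro!: nn_integral_cong)
  also have "\<dots> = (\<integral>\<^sup>+s. (g (hold l (hazard l s)) * ennreal (exp (- hazard l s))) *
      ennreal (flow \<alpha> \<beta> l s) * indicator {0..} s \<partial>lborel)"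
  proof (rule nn_integral_substitution_halfline[of "\<lambda>e. g (hold l e) * ennreal (exp (- e))"
        "hazard l" "flow \<alpha> \<beta> l", unfolded cov, symmetric])
    show "continuous_on UNIV (flow \<alpha> \<beta> l)" unfolding flow_def by (intro continuous_intros)
    show "0 \<le> flow \<alpha> \<beta> l x" if "0 \<le> x" for x
      using flow_between(1)[of \<alpha> x l \<beta>] \<alpha> that l \<beta> by auto
  qed (use hazard_deriv in \<open>auto\<close>)
  also have "\<dots> = (\<integral>\<^sup>+s\<in>{0..}. ennreal (snd (flow_state y s) * survival l s) * g s \<partial>lborel)"
  proof (rule nn_integral_cong)
    fix s :: real
    have "0 \<le> s \<Longrightarrow> 0 \<le> flow \<alpha> \<beta> l s"
      using flow_pos[OF y, of s] by (simp add: l_def)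
    then show "(g (hold l (hazard l s)) * ennreal (exp (- hazard l s))) *
        ennreal (flow \<alpha> \<beta> l s) * indicator {0..} s =
      ennreal (snd (flow_state y s) * survival l s) * g s * indicator {0..} s"
      using l by (auto simp: indicator_def hold_hazard flow_state_def l_def[symmetric] survival_def
          ennreal_mult mult_ac)
  qed
  finally show ?thesis unfolding l_def .
qed

section \<open>The jump chain and the path\<close>

abbreviation "skel \<equiv> skeleton \<alpha> \<beta> A lo ell"
abbreviation "pth \<equiv> path \<alpha> \<beta> A lo ell"

lemma fst_skel_Suc: "fst (skel y \<omega> (Suc k)) = fst (skel y \<omega> k) + hold (snd (snd (skel y \<omega> k))) (fst (\<omega> !! k))"
  by (simp add: case_prod_unfold Let_def)

lemma space_driving: "\<omega> \<in> space \<Omega> \<Longrightarrow> 0 \<le> snd (\<omega> !! k)"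
  by (auto simp: driving_def space_stream_space streams_iff_snth space_pair_measure space_G mem_Times_iff)

lemma snth_driving_measurable [measurable (raw)]:
  assumes "g \<in> M \<rightarrow>\<^sub>M \<Omega>"
  shows "(\<lambda>x. g x !! k) \<in> M \<rightarrow>\<^sub>M E \<Otimes>\<^sub>M G"
  using assms unfolding driving_def by measurable

lemma fst_mark_measurable [measurable (raw)]:
  assumes [measurable]: "g \<in> M \<rightarrow>\<^sub>M E \<Otimes>\<^sub>M G"
  shows "(\<lambda>x. fst (g x)) \<in> borel_measurable M"
proof -
  have "(\<lambda>x. fst (g x)) \<in> M \<rightarrow>\<^sub>M E" by measurable
  then show ?thesis by simp
qed

lemma Stream_driving_measurable [measurable (raw)]:
  assumes "f \<in> M \<rightarrow>\<^sub>M E \<Otimes>\<^sub>M G" "g \<in> M \<rightarrow>\<^sub>M \<Omega>"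
  shows "(\<lambda>x. f x ## g x) \<in> M \<rightarrow>\<^sub>M \<Omega>"
  using assms unfolding driving_def by measurable

lemma skel_in_S:
  assumes "y \<in> space S" "\<omega> \<in> space \<Omega>"
  shows "snd (skel y \<omega> k) \<in> space S"
proof (induction k)
  case 0 then show ?case using assms by simp
next
  case (Suc k)
  have "flow_state (snd (skel y \<omega> k)) (hold (snd (snd (skel y \<omega> k))) (fst (\<omega> !! k))) \<in> space S"
    using Suc by (rule flow_state_in_S)
  from jump_in_S[OF this space_driving[OF assms(2), of k]] show ?case
    using hold_nonneg[OF snd_S_pos[OF Suc]]
    by (simp add: case_prod_unfold Let_def flow_state_def)
qed

lemma snd_skel_Suc:
  assumes "y \<in> space S" "\<omega> \<in> space \<Omega>"
  shows "snd (skel y \<omega> (Suc k)) =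
    jmp (flow_state (snd (skel y \<omega> k)) (hold (snd (snd (skel y \<omega> k))) (fst (\<omega> !! k)))) (snd (\<omega> !! k))"
  using hold_nonneg[OF snd_S_pos[OF skel_in_S[OF assms, of k]]]
  by (simp add: case_prod_unfold Let_def flow_state_def)

lemma skel_measurable:
  assumes [measurable]: "f \<in> M \<rightarrow>\<^sub>M S" "g \<in> M \<rightarrow>\<^sub>M \<Omega>"
  shows "(\<lambda>x. fst (skel (f x) (g x) k)) \<in> borel_measurable M \<and> (\<lambda>x. snd (skel (f x) (g x) k)) \<in> M \<rightarrow>\<^sub>M S"
proof (induction k)
  case 0 then show ?case by simp
next
  case (Suc k)
  then have [measurable]: "(\<lambda>x. fst (skel (f x) (g x) k)) \<in> borel_measurable M"
     "(\<lambda>x. snd (skel (f x) (g x) k)) \<in> M \<rightarrow>\<^sub>M S" by auto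
  have "(\<lambda>x. snd (skel (f x) (g x) (Suc k))) \<in> M \<rightarrow>\<^sub>M S \<longleftrightarrow>
    (\<lambda>x. jmp (flow_state (snd (skel (f x) (g x) k)) (hold (snd (snd (skel (f x) (g x) k))) (fst (g x !! k)))) (snd (g x !! k)))
      \<in> M \<rightarrow>\<^sub>M S"
    using measurable_space[OF assms(1)] measurable_space[OF assms(2)]
    by (intro measurable_cong snd_skel_Suc) auto
  moreover have "(\<lambda>x. fst (skel (f x) (g x) (Suc k))) \<in> borel_measurable M"
    unfolding fst_skel_Suc by measurable
  moreover have "(\<lambda>x. jmp (flow_state (snd (skel (f x) (g x) k)) (hold (snd (snd (skel (f x) (g x) k))) (fst (g x !! k)))) (snd (g x !! k)))
      \<in> M \<rightarrow>\<^sub>M S"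
    by measurable
  ultimately show ?case by blast
qed

lemmas skel_measurable' [measurable (raw)] = skel_measurable[THEN conjunct1] skel_measurable[THEN conjunct2]

definition jump_index :: "nat \<times> real \<Rightarrow> (real \<times> real) stream \<Rightarrow> real \<Rightarrow> nat" where
  "jump_index y \<omega> t = (LEAST k. t < fst (skel y \<omega> (Suc k)))"

text \<open>If the \<open>LEAST\<close> has no witness its value is unspecified, yet
  \<open>not_less_Least\<close> still applies. Hence \<open>path_eq\<close> and the measurability of
  the path hold at every sample point, explosive or not.\<close>

lemma jump_index_le: "0 \<le> t \<Longrightarrow> fst (skel y \<omega> (jump_index y \<omega> t)) \<le> t"
proof (cases "jump_index y \<omega> t")
  case (Suc j)
  then have "j < jump_index y \<omega> t" by simp
  from not_less_Least[OF this[unfolded jump_index_def]] Suc show ?thesis by (simp add: not_less)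
qed simp

lemma path_eq:
  "0 \<le> t \<Longrightarrow> pth y \<omega> t =
    flow_state (snd (skel y \<omega> (jump_index y \<omega> t))) (t - fst (skel y \<omega> (jump_index y \<omega> t)))"
  using jump_index_le[of t y \<omega>]
  by (simp add: path_def jump_index_def[symmetric] Let_def case_prod_unfold flow_state_def
      del: skeleton.simps)

lemma jump_index_measurable [measurable (raw)]:
  assumes [measurable]: "f \<in> M \<rightarrow>\<^sub>M S" "g \<in> M \<rightarrow>\<^sub>M \<Omega>" "h \<in> borel_measurable M"
  shows "(\<lambda>x. jump_index (f x) (g x) (h x)) \<in> M \<rightarrow>\<^sub>M count_space UNIV"
  unfolding jump_index_def by measurable

lemma path_measurable [measurable (raw)]:
  assumes [measurable]: "f \<in> M \<rightarrow>\<^sub>M S" "g \<in> M \<rightarrow>\<^sub>M \<Omega>" "h \<in> borel_measurable M"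
  shows "(\<lambda>x. pth (f x) (g x) (max 0 (h x))) \<in> M \<rightarrow>\<^sub>M S"
proof -
  have "(\<lambda>x. flow_state (snd (skel (f x) (g x) (jump_index (f x) (g x) (max 0 (h x)))))
     (max 0 (h x) - fst (skel (f x) (g x) (jump_index (f x) (g x) (max 0 (h x)))))) \<in> M \<rightarrow>\<^sub>M S"
    by (rule measurable_compose_countable[of "\<lambda>k x. flow_state (snd (skel (f x) (g x) k))
       (max 0 (h x) - fst (skel (f x) (g x) k))"]) measurable
  then show ?thesis by (simp add: path_eq)
qed

text \<open>The recursion of \<open>skeleton\<close> splits off the last jump; a renewal argument
  has to split off the first one.\<close>

lemma skel_Stream:
  fixes x :: "real \<times> real"
  assumes "y \<in> space S"
  defines "\<tau> \<equiv> hold (snd y) (fst x)"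
  shows "skel y (x ## \<omega>) (Suc k) =
    (\<tau> + fst (skel (jmp (flow_state y \<tau>) (snd x)) \<omega> k), snd (skel (jmp (flow_state y \<tau>) (snd x)) \<omega> k))"
proof (induction k)
  case 0 show ?case
    using hold_nonneg[OF snd_S_pos[OF assms(1)]]
    by (simp add: \<tau>_def case_prod_unfold Let_def flow_state_def)
next
  case (Suc k)
  show ?case
    by (subst skeleton.simps(2), subst Suc) (simp add: case_prod_unfold Let_def add.assoc)
qed

text \<open>The Markov property at the first jump, path by path. The hypothesis on the jump times
  makes the \<open>LEAST\<close> after the restart a genuine minimum, so that
  \<open>Least_Suc\<close> shifts the index by one.\<close>

lemma path_Stream:
  fixes x :: "real \<times> real"
  assumes y: "y \<in> space S" and t: "0 \<le> t"
  defines "\<tau> \<equiv> hold (snd y) (fst x)"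
  defines "y' \<equiv> jmp (flow_state y \<tau>) (snd x)"
  assumes ex: "\<exists>k. t - \<tau> < fst (skel y' \<omega> (Suc k))"
  shows "pth y (x ## \<omega>) t = (if t < \<tau> then flow_state y t else pth y' \<omega> (t - \<tau>))"
proof (cases "t < \<tau>")
  case True
  then have "jump_index y (x ## \<omega>) t = 0"
    unfolding jump_index_def using skel_Stream[OF y, of x \<omega> 0]
    by (intro Least_equality) (auto simp: \<tau>_def)
  with True t show ?thesis by (simp add: path_eq)
next
  case False
  have s: "skel y (x ## \<omega>) (Suc k) = (\<tau> + fst (skel y' \<omega> k), snd (skel y' \<omega> k))" for k
    unfolding y'_def \<tau>_def by (rule skel_Stream[OF y])
  have iff: "t < fst (skel y (x ## \<omega>) (Suc (Suc k))) \<longleftrightarrow> t - \<tau> < fst (skel y' \<omega> (Suc k))" for k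
    by (subst s) auto
  from ex obtain k where "t < fst (skel y (x ## \<omega>) (Suc (Suc k)))" using iff by blast
  moreover have "\<not> t < fst (skel y (x ## \<omega>) (Suc 0))"
    using False by (subst s) simp
  ultimately have "jump_index y (x ## \<omega>) t = Suc (jump_index y' \<omega> (t - \<tau>))"
    unfolding jump_index_def iff[symmetric] by (rule Least_Suc)
  then show ?thesis using False t
    by (simp add: path_eq s diff_diff_eq del: skeleton.simps)
qed

section \<open>Non-explosion\<close>

lemma nn_integral_driving:
  assumes "f \<in> borel_measurable \<Omega>"
  shows "(\<integral>\<^sup>+\<omega>. f \<omega> \<partial>\<Omega>) = (\<integral>\<^sup>+e. (\<integral>\<^sup>+z. (\<integral>\<^sup>+\<omega>. f ((e, z) ## \<omega>) \<partial>\<Omega>) \<partial>G) \<partial>E)"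
proof -
  note [measurable] = assms
  have "(\<integral>\<^sup>+\<omega>. f \<omega> \<partial>\<Omega>) = (\<integral>\<^sup>+x. (\<integral>\<^sup>+\<omega>. f (x ## \<omega>) \<partial>\<Omega>) \<partial>(E \<Otimes>\<^sub>M G))"
    using assms unfolding driving_def by (rule EG.P.nn_integral_stream_space)
  also have "\<dots> = (\<integral>\<^sup>+e. (\<integral>\<^sup>+z. (\<integral>\<^sup>+\<omega>. f ((e, z) ## \<omega>) \<partial>\<Omega>) \<partial>G) \<partial>E)"
    by (rule G.nn_integral_fst[symmetric]) measurable
  finally show ?thesis .
qed

text \<open>The Laplace transform of the unit exponential law at one: multiplying its density by
  \<open>exp (- e)\<close> gives half the density of rate two.\<close>

lemma nn_integral_exp_E: "(\<integral>\<^sup>+e. ennreal (exp (- e)) \<partial>E) = ennreal (1 / 2)"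
proof -
  interpret E2: prob_space "density lborel (exponential_density 2)"
    by (rule prob_space_exponential_density) simp
  have "(\<integral>\<^sup>+e. ennreal (exp (- e)) \<partial>E) = (\<integral>\<^sup>+e. ennreal (1 / 2) * ennreal (exponential_density 2 e) \<partial>lborel)"
  proof (subst nn_integral_density; (simp only: ennreal_mult[symmetric])?)
    have "exponential_density 1 e * exp (- e) = 1 / 2 * exponential_density 2 e" for e :: real
      by (simp add: exponential_density_def exp_add[symmetric])
    then show "(\<integral>\<^sup>+e. ennreal (exponential_density 1 e) * ennreal (exp (- e)) \<partial>lborel) =
        (\<integral>\<^sup>+e. ennreal (1 / 2) * ennreal (exponential_density 2 e) \<partial>lborel)"
      by (intro nn_integral_cong) (simp only: ennreal_mult[symmetric] exponential_density_nonneg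
          exp_ge_zero zero_less_one zero_less_numeral divide_nonneg_nonneg zero_le_one zero_le_numeral)
  qed auto
  also have "\<dots> = ennreal (1 / 2) * (\<integral>\<^sup>+e. 1 \<partial>density lborel (exponential_density 2))"
    by (subst nn_integral_cmult, simp) (simp add: emeasure_density)
  also have "\<dots> = ennreal (1 / 2)"
    using E2.emeasure_space_1 by simp
  finally show ?thesis .
qed

lemma nn_integral_exp_sum:
  "(\<integral>\<^sup>+\<omega>. ennreal (exp (- (\<Sum>k<n. fst (\<omega> !! k)))) \<partial>\<Omega>) = ennreal ((1 / 2) ^ n)"
proof (induction n)
  case 0 then show ?case by (simp add: \<Omega>.emeasure_space_1)
next
  case (Suc n)
  have "(\<integral>\<^sup>+\<omega>. ennreal (exp (- (\<Sum>k<Suc n. fst (\<omega> !! k)))) \<partial>\<Omega>) =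
    (\<integral>\<^sup>+e. (\<integral>\<^sup>+z. (\<integral>\<^sup>+\<omega>. ennreal (exp (- e)) * ennreal (exp (- (\<Sum>k<n. fst (\<omega> !! k)))) \<partial>\<Omega>) \<partial>G) \<partial>E)"
    by (subst nn_integral_driving, measurable)
       (auto simp: sum.lessThan_Suc_shift ennreal_mult[symmetric] exp_add[symmetric] simp del: sum.lessThan_Suc)
  also have "\<dots> = (\<integral>\<^sup>+e. ennreal (exp (- e)) \<partial>E) * ennreal ((1 / 2) ^ n)"
    by (simp add: nn_integral_cmult nn_integral_multc Suc G.emeasure_space_1)
  also have "\<dots> = ennreal ((1 / 2) ^ Suc n)"
    unfolding nn_integral_exp_E power_Suc by (rule ennreal_mult[symmetric]) auto
  finally show ?case .
qed

text \<open>The infimum over \<open>n\<close> of \<open>exp\<close> of minus the partial sums has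
  expectation at most \<open>(1 / 2) ^ n\<close> for every \<open>n\<close>. It therefore vanishes
  almost surely, which forces some partial sum above any given \<open>c\<close>.\<close>

lemma AE_sum_unbounded: "AE \<omega> in \<Omega>. \<forall>c. \<exists>n. c < (\<Sum>k<n. fst (\<omega> !! k))"
proof -
  let ?D = "\<lambda>n \<omega>. ennreal (exp (- (\<Sum>k<n. fst (\<omega> !! k))))"
  have "(\<integral>\<^sup>+\<omega>. (INF n. ?D n \<omega>) \<partial>\<Omega>) \<le> ennreal ((1 / 2) ^ n)" for n
    unfolding nn_integral_exp_sum[symmetric] by (intro nn_integral_mono INF_lower) simp
  moreover have "(\<lambda>n. ennreal ((1 / 2) ^ n)) \<longlonglongrightarrow> ennreal 0"
    by (intro tendsto_ennrealI LIMSEQ_power_zero) simp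
  ultimately have "(\<integral>\<^sup>+\<omega>. (INF n. ?D n \<omega>) \<partial>\<Omega>) \<le> 0"
    by (intro LIMSEQ_le_const[of _ 0]) auto
  then have "AE \<omega> in \<Omega>. (INF n. ?D n \<omega>) = 0"
    by (subst nn_integral_0_iff_AE[symmetric]) auto
  then show ?thesis
  proof eventually_elim
    case (elim \<omega>)
    show ?case
    proof
      fix c
      have "(INF n. ?D n \<omega>) < ennreal (exp (- c))" unfolding elim by simp
      then show "\<exists>n. c < (\<Sum>k<n. fst (\<omega> !! k))"
        by (auto simp: INF_less_iff ennreal_less_iff)
    qed
  qed
qed

text \<open>The intensity never exceeds \<open>A\<close>, so accumulating \<open>e\<close> takes at
  least time \<open>e / A\<close>.\<close>

lemma hold_lower: "0 < l \<Longrightarrow> l < A \<Longrightarrow> e / A \<le> hold l e"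
proof -
  assume l: "0 < l" "l < A"
  have h: "0 \<le> hold l e" using l by (intro hold_nonneg)
  then have "e \<le> hazard l (hold l e)"
    using hold_gt_iff[OF l(1) h, of e] by simp
  also have "\<dots> \<le> hold l e * max l \<beta>" using h by (rule hazard_upper)
  also have "\<dots> \<le> hold l e * A" using h l \<beta> by (intro mult_left_mono) auto
  finally show ?thesis using \<beta> by (simp add: field_simps)
qed

lemma skel_time_lower:
  assumes "y \<in> space S" "\<omega> \<in> space \<Omega>"
  shows "(\<Sum>k<n. fst (\<omega> !! k)) / A \<le> fst (skel y \<omega> n)"
proof (induction n)
  case (Suc n)
  have "snd (skel y \<omega> n) \<in> space S" using assms by (rule skel_in_S)
  with lo hold_lower[of "snd (snd (skel y \<omega> n))" "fst (\<omega> !! n)"]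
  have "fst (\<omega> !! n) / A \<le> hold (snd (snd (skel y \<omega> n))) (fst (\<omega> !! n))" by (auto simp: space_S)
  with Suc show ?case unfolding fst_skel_Suc by (simp add: add_divide_distrib)
qed simp

text \<open>The bound of \<open>skel_time_lower\<close> involves only the sample point, so one null
  set serves every starting state and every time.\<close>

lemma AE_no_explosion: "AE \<omega> in \<Omega>. \<forall>y\<in>space S. \<forall>t. \<exists>k. t < fst (skel y \<omega> (Suc k))"
  using AE_sum_unbounded AE_space
proof eventually_elim
  case (elim \<omega>)
  show ?case
  proof (intro ballI allI)
    fix y t assume y: "y \<in> space S"
    \<comment> \<open>The maximum with zero rules out \<open>n = 0\<close>, since the skeleton
      starts at time zero; hence \<open>n\<close> is a successor.\<close>
    obtain n where "max 0 t * A < (\<Sum>k<n. fst (\<omega> !! k))" using elim by blast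
    then have "max 0 t < (\<Sum>k<n. fst (\<omega> !! k)) / A" using \<beta> by (intro pos_less_divide_eq[THEN iffD2]) auto
    also have "\<dots> \<le> fst (skel y \<omega> n)" using y elim by (intro skel_time_lower) auto
    finally have "max 0 t < fst (skel y \<omega> n)" .
    then show "\<exists>k. t < fst (skel y \<omega> (Suc k))" by (cases n) auto
  qed
qed

section \<open>The renewal equation\<close>

definition mark :: "(nat \<times> real \<Rightarrow> ennreal) \<Rightarrow> nat \<times> real \<Rightarrow> ennreal" where
  "mark g y = (\<integral>\<^sup>+z. g (jmp y z) \<partial>G)"

text \<open>The transition semigroup acting on \<open>f\<close>. Truncation at zero lets
  \<open>semi f (t - s)\<close> be used as a measurable function of all real
  \<open>s\<close>.\<close>

definition semi :: "(nat \<times> real \<Rightarrow> ennreal) \<Rightarrow> real \<Rightarrow> nat \<times> real \<Rightarrow> ennreal" where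
  "semi f t y = (\<integral>\<^sup>+\<omega>. f (pth y \<omega> (max 0 t)) \<partial>\<Omega>)"

definition potential :: "(nat \<times> real \<Rightarrow> ennreal) \<Rightarrow> real \<Rightarrow> nat \<times> real \<Rightarrow> ennreal" where
  "potential f t y = (\<integral>\<^sup>+s\<in>{0..t}. semi f s y \<partial>lborel)"

text \<open>The expected integral of \<open>f\<close> along the process up to its first jump, with
  the expectation already carried out: before the jump the path is the flow, and it is still running
  at time \<open>s\<close> with probability \<open>survival\<close>.\<close>

definition occ :: "(nat \<times> real \<Rightarrow> ennreal) \<Rightarrow> nat \<times> real \<Rightarrow> ennreal" where
  "occ f y = (\<integral>\<^sup>+s\<in>{0..}. f (flow_state y s) * ennreal (survival (snd y) s) \<partial>lborel)"

lemma semi_measurable [measurable (raw)]: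
  assumes [measurable]: "f \<in> borel_measurable S" "h \<in> borel_measurable M" "k \<in> M \<rightarrow>\<^sub>M S"
  shows "(\<lambda>x. semi f (h x) (k x)) \<in> borel_measurable M"
  unfolding semi_def by measurable

lemma mark_measurable [measurable (raw)]:
  assumes [measurable]: "(\<lambda>(x, y). g x y) \<in> borel_measurable (M \<Otimes>\<^sub>M S)" "k \<in> M \<rightarrow>\<^sub>M S"
  shows "(\<lambda>x. mark (g x) (k x)) \<in> borel_measurable M"
proof -
  have "(\<lambda>x. \<integral>\<^sup>+z. (case (x, jmp (k x) z) of (x, y) \<Rightarrow> g x y) \<partial>G) \<in> borel_measurable M"
    by measurable
  then show ?thesis by (simp add: mark_def)
qed

lemma potential_measurable [measurable (raw)]:
  assumes [measurable]: "f \<in> borel_measurable S" "k \<in> M \<rightarrow>\<^sub>M S"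
  shows "(\<lambda>x. potential f t (k x)) \<in> borel_measurable M"
  unfolding potential_def by measurable

lemma occ_measurable [measurable (raw)]:
  assumes [measurable]: "f \<in> borel_measurable S" "k \<in> M \<rightarrow>\<^sub>M S"
  shows "(\<lambda>x. occ f (k x)) \<in> borel_measurable M"
  unfolding occ_def by measurable

text \<open>Integrates \<open>path_Stream\<close> over the first pair of the stream and the
  independent rest, whose law is again that of the whole stream; \<open>AE_no_explosion\<close>
  supplies the hypothesis on the jump times.\<close>

lemma semi_renewal_hold:
  assumes y: "y \<in> space S" and t: "0 \<le> t" and [measurable]: "f \<in> borel_measurable S"
  shows "semi f t y = (\<integral>\<^sup>+e. (if t < hold (snd y) e then f (flow_state y t)
     else mark (semi f (t - hold (snd y) e)) (flow_state y (hold (snd y) e))) \<partial>E)"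
proof -
  note [measurable] = y
  have "semi f t y = (\<integral>\<^sup>+e. (\<integral>\<^sup>+z. (\<integral>\<^sup>+\<omega>. f (pth y ((e, z) ## \<omega>) (max 0 t)) \<partial>\<Omega>) \<partial>G) \<partial>E)"
    unfolding semi_def by (rule nn_integral_driving) measurable
  also have "\<dots> = (\<integral>\<^sup>+e. (\<integral>\<^sup>+z. (if t < hold (snd y) e then f (flow_state y t)
     else semi f (t - hold (snd y) e) (jmp (flow_state y (hold (snd y) e)) z)) \<partial>G) \<partial>E)"
  proof (intro nn_integral_cong)
    fix e z assume z: "z \<in> space G"
    let ?\<tau> = "hold (snd y) e" let ?y = "jmp (flow_state y ?\<tau>) z"
    have y': "?y \<in> space S" using y z by (intro jump_in_S flow_state_in_S) (auto simp: space_G)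
    have "(\<integral>\<^sup>+\<omega>. f (pth y ((e, z) ## \<omega>) (max 0 t)) \<partial>\<Omega>) =
       (\<integral>\<^sup>+\<omega>. (if t < ?\<tau> then f (flow_state y t) else f (pth ?y \<omega> (max 0 (t - ?\<tau>)))) \<partial>\<Omega>)"
    proof (rule nn_integral_cong_AE)
      show "AE \<omega> in \<Omega>. f (pth y ((e, z) ## \<omega>) (max 0 t)) =
         (if t < ?\<tau> then f (flow_state y t) else f (pth ?y \<omega> (max 0 (t - ?\<tau>))))"
        using AE_no_explosion
      proof eventually_elim
        case (elim \<omega>)
        have "\<exists>k. t - hold (snd y) (fst (e, z)) < fst (skel (jmp (flow_state y (hold (snd y) (fst (e, z)))) (snd (e, z))) \<omega> (Suc k))"
          using elim y' by simp
        from path_Stream[OF y t this] show ?case using t by (simp add: max_def)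
      qed
    qed
    also have "\<dots> = (if t < ?\<tau> then f (flow_state y t) else semi f (t - ?\<tau>) ?y)"
      by (simp add: semi_def \<Omega>.emeasure_space_1)
    finally show "(\<integral>\<^sup>+\<omega>. f (pth y ((e, z) ## \<omega>) (max 0 t)) \<partial>\<Omega>) = \<dots>" .
  qed
  also have "\<dots> = (\<integral>\<^sup>+e. (if t < hold (snd y) e then f (flow_state y t)
     else mark (semi f (t - hold (snd y) e)) (flow_state y (hold (snd y) e))) \<partial>E)"
    by (intro nn_integral_cong) (simp add: mark_def G.emeasure_space_1)
  finally show ?thesis .
qed

text \<open>Read backwards through \<open>nn_integral_hold\<close>, the integral is the probability
  that the holding time exceeds \<open>t\<close>, which \<open>prob_holding_gt\<close>
  gives.\<close>

lemma nn_integral_hold_tail: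
  assumes y: "y \<in> space S" and t: "0 \<le> t"
  shows "(\<integral>\<^sup>+s\<in>{0..}. ennreal (snd (flow_state y s) * survival (snd y) s) * indicator {t<..} s \<partial>lborel) =
    ennreal (survival (snd y) t)"
proof -
  note [measurable] = y
  have "(\<integral>\<^sup>+s\<in>{0..}. ennreal (snd (flow_state y s) * survival (snd y) s) * indicator {t<..} s \<partial>lborel) =
      (\<integral>\<^sup>+e. indicator {t<..} (hold (snd y) e) \<partial>E)"
    by (rule nn_integral_hold[symmetric]) (use y in measurable)
  also have "\<dots> = (\<integral>\<^sup>+e. indicator {e. t < hold (snd y) e} e \<partial>E)"
    by (intro nn_integral_cong) (auto simp: indicator_def)
  also have "\<dots> = emeasure E {e. t < hold (snd y) e}"
    by (rule nn_integral_indicator) simp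
  also have "\<dots> = ennreal (survival (snd y) t)"
    using prob_holding_gt[of \<alpha> \<beta> "snd y" t] \<alpha> \<beta> snd_S_pos[OF y] t
    by (simp add: E.emeasure_eq_measure integral_flow survival_def)
  finally show ?thesis .
qed

lemma semi_renewal:
  assumes y: "y \<in> space S" and t: "0 \<le> t" and [measurable]: "f \<in> borel_measurable S"
  shows "semi f t y = f (flow_state y t) * ennreal (survival (snd y) t) +
    (\<integral>\<^sup>+s\<in>{0..t}. ennreal (snd (flow_state y s) * survival (snd y) s) * mark (semi f (t - s)) (flow_state y s) \<partial>lborel)"
proof -
  note [measurable] = y
  let ?d = "\<lambda>s. ennreal (snd (flow_state y s) * survival (snd y) s)"
  let ?m = "\<lambda>s. mark (semi f (t - s)) (flow_state y s)"
  have "semi f t y = (\<integral>\<^sup>+s\<in>{0..}. ?d s * (if t < s then f (flow_state y t) else ?m s) \<partial>lborel)"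
    unfolding semi_renewal_hold[OF y t assms(3)]
    by (rule nn_integral_hold[OF y]) measurable
  also have "\<dots> = (\<integral>\<^sup>+s. f (flow_state y t) * (?d s * indicator {t<..} s * indicator {0..} s) +
       ?d s * ?m s * indicator {0..t} s \<partial>lborel)"
    using t by (intro nn_integral_cong) (auto simp: indicator_def mult_ac)
  also have "\<dots> = (\<integral>\<^sup>+s. f (flow_state y t) * (?d s * indicator {t<..} s * indicator {0..} s) \<partial>lborel) +
      (\<integral>\<^sup>+s\<in>{0..t}. ?d s * ?m s \<partial>lborel)"
    by (rule nn_integral_add) measurable
  also have "(\<integral>\<^sup>+s. f (flow_state y t) * (?d s * indicator {t<..} s * indicator {0..} s) \<partial>lborel) =
      f (flow_state y t) * (\<integral>\<^sup>+s. (?d s * indicator {t<..} s * indicator {0..} s) \<partial>lborel)"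
    by (rule nn_integral_cmult) measurable
  finally show ?thesis unfolding nn_integral_hold_tail[OF y t] .
qed

lemma nn_integral_halfline_split:
  fixes b :: "real \<Rightarrow> ennreal"
  assumes [measurable]: "b \<in> borel_measurable borel" and t: "0 \<le> t"
  shows "(\<integral>\<^sup>+s\<in>{0..}. b (s + t) \<partial>lborel) + (\<integral>\<^sup>+s\<in>{0..t}. b s \<partial>lborel) = (\<integral>\<^sup>+s\<in>{0..}. b s \<partial>lborel)"
proof -
  have "(\<integral>\<^sup>+s\<in>{0..}. b (s + t) \<partial>lborel) = (\<integral>\<^sup>+s\<in>{t..}. b s \<partial>lborel)"
    by (subst (2) nn_integral_real_affine[where c=1 and t=t])
       (auto intro!: nn_integral_cong simp: indicator_def add.commute)
  then have "(\<integral>\<^sup>+s\<in>{0..}. b (s + t) \<partial>lborel) + (\<integral>\<^sup>+s\<in>{0..t}. b s \<partial>lborel) =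
     (\<integral>\<^sup>+s. b s * indicator {t..} s + b s * indicator {0..t} s \<partial>lborel)"
    by (simp add: nn_integral_add)
  also have "\<dots> = (\<integral>\<^sup>+s\<in>{0..}. b s \<partial>lborel)"
  proof (rule nn_integral_cong_AE)
    show "AE s in lborel. b s * indicator {t..} s + b s * indicator {0..t} s = b s * indicator {0..} s"
      using AE_lborel_singleton[of t] by eventually_elim (use t in \<open>auto simp: indicator_def\<close>)
  qed
  finally show ?thesis .
qed

text \<open>The four terms are the expectations of the four integrals in the renewal identity, in
  the same order. Each is expanded by \<open>semi_renewal\<close> into a part without jump and a
  part with a first jump: \<open>nn_integral_halfline_split\<close> balances the former,
  \<open>nn_integral_strip_split\<close> the latter.\<close>

lemma occ_semi:
  assumes y: "y \<in> space S" and t: "0 \<le> t" and [measurable]: "f \<in> borel_measurable S"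
  shows "occ (semi f t) y + potential f t y =
    occ f y + occ (\<lambda>x. ennreal (snd x) * mark (potential f t) x) y"
proof -
  note [measurable] = y
  define d where "d s = ennreal (snd (flow_state y s) * survival (snd y) s)" for s
  \<comment> \<open>\<open>a r v\<close> is the contribution of a first jump at time
    \<open>r\<close> observed \<open>v\<close> time units later; \<open>b s\<close> is the
    contribution at time \<open>s\<close> if no jump has happened yet.\<close>
  define a where "a r v = d r * mark (semi f v) (flow_state y r)" for r v
  define b where "b s = f (flow_state y s) * ennreal (survival (snd y) s)" for s
  have d[measurable]: "d \<in> borel_measurable borel" unfolding d_def by measurable
  have a[measurable]: "case_prod a \<in> borel_measurable (borel \<Otimes>\<^sub>M borel)"
    unfolding a_def by measurable
  have a'[measurable (raw)]: "(\<lambda>x. a (h x) (k x)) \<in> borel_measurable M"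
    if [measurable]: "h \<in> borel_measurable M" "k \<in> borel_measurable M"
    for h k and M :: "'b measure"
    unfolding a_def by measurable
  have b[measurable]: "b \<in> borel_measurable borel" unfolding b_def by measurable
  \<comment> \<open>Surviving for time \<open>s\<close> and then jumping after a further
    \<open>r\<close> is a first jump at time \<open>s + r\<close>.\<close>
  have d_add: "ennreal (survival (snd y) s) *
      ennreal (snd (flow_state (flow_state y s) r) * survival (snd (flow_state y s)) r) = d (s + r)"
    if "0 \<le> s" "0 \<le> r" for s r
    using that snd_S_pos[OF flow_state_in_S[OF y, of "s + r"]]
    by (simp add: d_def flow_state_add survival_add snd_flow_state ennreal_mult[symmetric] flow_add mult_ac)
  have "occ (semi f t) y = (\<integral>\<^sup>+s\<in>{0..}. (b (s + t) + (\<integral>\<^sup>+r\<in>{0..t}. a (s + r) (t - r) \<partial>lborel)) \<partial>lborel)"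
    unfolding occ_def
  proof (rule nn_integral_cong)
    fix s :: real
    show "semi f t (flow_state y s) * ennreal (survival (snd y) s) * indicator {0..} s =
      (b (s + t) + (\<integral>\<^sup>+r\<in>{0..t}. a (s + r) (t - r) \<partial>lborel)) * indicator {0..} s"
    proof (cases "0 \<le> s")
      case True
      have ys: "flow_state y s \<in> space S" using y by (rule flow_state_in_S)
      note [measurable] = ys
      have "ennreal (survival (snd y) s) * (f (flow_state (flow_state y s) t) * ennreal (survival (snd (flow_state y s)) t)) = b (s + t)"
        using True t by (simp add: b_def flow_state_add survival_add snd_flow_state ennreal_mult mult_ac)
      moreover have "ennreal (survival (snd y) s) * (\<integral>\<^sup>+r\<in>{0..t}. ennreal (snd (flow_state (flow_state y s) r) * survival (snd (flow_state y s)) r) *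
           mark (semi f (t - r)) (flow_state (flow_state y s) r) \<partial>lborel) = (\<integral>\<^sup>+r\<in>{0..t}. a (s + r) (t - r) \<partial>lborel)"
        by (subst nn_integral_cmult[symmetric], measurable, rule nn_integral_cong)
           (use True in \<open>auto simp: indicator_def a_def d_add[symmetric] flow_state_add mult.assoc\<close>)
      ultimately show ?thesis
        unfolding semi_renewal[OF ys t assms(3)] by (simp add: distrib_left mult.commute)
    qed simp
  qed
  also have "\<dots> = (\<integral>\<^sup>+s\<in>{0..}. b (s + t) \<partial>lborel) + (\<integral>\<^sup>+s\<in>{0..}. (\<integral>\<^sup>+r\<in>{0..t}. a (s + r) (t - r) \<partial>lborel) \<partial>lborel)"
    unfolding distrib_right by (rule nn_integral_add) measurable
  finally have 1: "occ (semi f t) y = \<dots>" .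
  have "potential f t y = (\<integral>\<^sup>+s\<in>{0..t}. (b s + (\<integral>\<^sup>+r\<in>{0..s}. a r (s - r) \<partial>lborel)) \<partial>lborel)"
    unfolding potential_def
    by (rule nn_integral_cong) (auto simp: indicator_def semi_renewal[OF y _ assms(3)] a_def b_def d_def)
  also have "\<dots> = (\<integral>\<^sup>+s\<in>{0..t}. b s \<partial>lborel) + (\<integral>\<^sup>+s\<in>{0..t}. (\<integral>\<^sup>+r\<in>{0..s}. a r (s - r) \<partial>lborel) \<partial>lborel)"
    unfolding distrib_right by (rule nn_integral_add) measurable
  finally have 2: "potential f t y = \<dots>" .
  have 3: "occ f y = (\<integral>\<^sup>+s\<in>{0..}. b s \<partial>lborel)" by (simp add: occ_def b_def)
  interpret GL: pair_sigma_finite G lborel ..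
  have mark_pot: "mark (potential f t) x = (\<integral>\<^sup>+v\<in>{0..t}. mark (semi f v) x \<partial>lborel)" if x: "x \<in> space S" for x
  proof -
    note [measurable] = x
    have "mark (potential f t) x = (\<integral>\<^sup>+z. (\<integral>\<^sup>+v. semi f v (jmp x z) * indicator {0..t} v \<partial>lborel) \<partial>G)"
      by (simp add: mark_def potential_def)
    also have "\<dots> = (\<integral>\<^sup>+v. (\<integral>\<^sup>+z. semi f v (jmp x z) * indicator {0..t} v \<partial>G) \<partial>lborel)"
      by (rule GL.Fubini'[symmetric]) measurable
    also have "\<dots> = (\<integral>\<^sup>+v\<in>{0..t}. mark (semi f v) x \<partial>lborel)"
      unfolding mark_def by (intro nn_integral_cong nn_integral_multc) measurable
    finally show ?thesis .
  qed
  have "occ (\<lambda>x. ennreal (snd x) * mark (potential f t) x) y =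
     (\<integral>\<^sup>+r. (\<integral>\<^sup>+v. a r v * indicator {0..t} v * indicator {0..} r \<partial>lborel) \<partial>lborel)"
    unfolding occ_def
  proof (rule nn_integral_cong)
    fix r :: real
    have yr: "flow_state y r \<in> space S" using y by (rule flow_state_in_S)
    have "(\<integral>\<^sup>+v. a r v * indicator {0..t} v * indicator {0..} r \<partial>lborel) =
        (\<integral>\<^sup>+v. d r * indicator {0..} r * (mark (semi f v) (flow_state y r) * indicator {0..t} v) \<partial>lborel)"
      by (intro nn_integral_cong) (simp add: a_def mult_ac)
    also have "\<dots> = d r * indicator {0..} r * (\<integral>\<^sup>+v\<in>{0..t}. mark (semi f v) (flow_state y r) \<partial>lborel)"
      using yr by (intro nn_integral_cmult) measurable
    also have "\<dots> = ennreal (snd (flow_state y r)) * mark (potential f t) (flow_state y r) * ennreal (survival (snd y) r) * indicator {0..} r"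
      using snd_S_pos[OF yr] by (simp add: mark_pot[OF yr] d_def ennreal_mult mult_ac)
    finally show "ennreal (snd (flow_state y r)) * mark (potential f t) (flow_state y r) * ennreal (survival (snd y) r) * indicator {0..} r =
       (\<integral>\<^sup>+v. a r v * indicator {0..t} v * indicator {0..} r \<partial>lborel)" ..
  qed
  also have "\<dots> = (\<integral>\<^sup>+v. (\<integral>\<^sup>+r. a r v * indicator {0..t} v * indicator {0..} r \<partial>lborel) \<partial>lborel)"
    by (rule lborel_pair.Fubini'[symmetric]) measurable
  also have "\<dots> = (\<integral>\<^sup>+v\<in>{0..t}. (\<integral>\<^sup>+r\<in>{0..}. a r v \<partial>lborel) \<partial>lborel)"
    by (intro nn_integral_cong) (simp add: indicator_def)
  finally have 4: "occ (\<lambda>x. ennreal (snd x) * mark (potential f t) x) y = \<dots>" .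
  show ?thesis
    unfolding 1 2 3 4 nn_integral_strip_split[OF a t, symmetric] nn_integral_halfline_split[OF b t, symmetric]
    by (simp add: add_ac)
qed

section \<open>Cycles\<close>

text \<open>The jump is spelled out because this explicit form becomes a shift by a variable of law
  \<open>jump_law\<close> in \<open>mark0_eq_J\<close>; \<open>mark0_eq\<close> restores
  \<open>jmp\<close>, which suits measurability.\<close>

definition mark0 :: "(nat \<times> real \<Rightarrow> ennreal) \<Rightarrow> nat \<times> real \<Rightarrow> ennreal" where
  "mark0 g y = (\<integral>\<^sup>+z. (if snd y + ell (Suc (fst y)) z < A
     then g (Suc (fst y), snd y + ell (Suc (fst y)) z) else 0) \<partial>G)"

definition reset_prob :: "nat \<times> real \<Rightarrow> ennreal" where
  "reset_prob y = (\<integral>\<^sup>+z. indicator {z. A \<le> snd y + ell (Suc (fst y)) z} z \<partial>G)"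

text \<open>The kernel of the jump chain killed at a reset. By \<open>occ_hold\<close>, the weight
  \<open>snd y\<close> turns the occupation time into the law of the state just before the next
  jump.\<close>

definition step :: "(nat \<times> real \<Rightarrow> ennreal) \<Rightarrow> nat \<times> real \<Rightarrow> ennreal" where
  "step g = occ (\<lambda>y. ennreal (snd y) * mark0 g y)"

definition reset_step :: "nat \<times> real \<Rightarrow> ennreal" where
  "reset_step = occ (\<lambda>y. ennreal (snd y) * reset_prob y)"

text \<open>The law of the state after the \<open>n\<close>-th jump of a cycle, restricted to the event
  that none of these jumps is a reset.\<close>

definition cycle_law :: "nat \<Rightarrow> (nat \<times> real \<Rightarrow> ennreal) \<Rightarrow> ennreal" where
  "cycle_law n g = (step ^^ n) g (0, lo)"

lemma mark0_eq: "mark0 g y = (\<integral>\<^sup>+z. (if snd y + ell (Suc (fst y)) z < A then g (jmp y z) else 0) \<partial>G)"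
  unfolding mark0_def jump_def by (intro nn_integral_cong) simp

lemma mark0_measurable [measurable (raw)]:
  assumes [measurable]: "g \<in> borel_measurable S" "k \<in> M \<rightarrow>\<^sub>M S"
  shows "(\<lambda>x. mark0 g (k x)) \<in> borel_measurable M"
  unfolding mark0_eq by measurable

lemma reset_prob_measurable [measurable (raw)]:
  assumes [measurable]: "k \<in> M \<rightarrow>\<^sub>M S"
  shows "(\<lambda>x. reset_prob (k x)) \<in> borel_measurable M"
  unfolding reset_prob_def indicator_def mem_Collect_eq by measurable

lemma step_measurable [measurable (raw)]:
  assumes [measurable]: "g \<in> borel_measurable S" "k \<in> M \<rightarrow>\<^sub>M S"
  shows "(\<lambda>x. step g (k x)) \<in> borel_measurable M"
  unfolding step_def by measurable

lemma reset_step_measurable [measurable (raw)]: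
  assumes [measurable]: "k \<in> M \<rightarrow>\<^sub>M S"
  shows "(\<lambda>x. reset_step (k x)) \<in> borel_measurable M"
  unfolding reset_step_def by measurable

lemma funpow_step_measurable [measurable]:
  "g \<in> borel_measurable S \<Longrightarrow> (step ^^ n) g \<in> borel_measurable S"
  by (induction n) simp_all

text \<open>A reset forgets the state before the jump, so its contribution factorises into its
  probability and the value at \<open>(0, lo)\<close>.\<close>

lemma mark_split:
  assumes y: "y \<in> space S" and [measurable]: "g \<in> borel_measurable S"
  shows "mark g y = mark0 g y + reset_prob y * g (0, lo)"
proof -
  note [measurable] = y
  have [measurable]: "Measurable.pred G (\<lambda>z. A \<le> snd y + ell (Suc (fst y)) z)" by measurable
  have "mark g y = (\<integral>\<^sup>+z. (if snd y + ell (Suc (fst y)) z < A then g (jmp y z) else 0) +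
      indicator {z. A \<le> snd y + ell (Suc (fst y)) z} z * g (0, lo) \<partial>G)"
    unfolding mark_def by (intro nn_integral_cong) (auto simp: indicator_def jump_def)
  also have "\<dots> = mark0 g y + (\<integral>\<^sup>+z. indicator {z. A \<le> snd y + ell (Suc (fst y)) z} z * g (0, lo) \<partial>G)"
    unfolding mark0_eq indicator_def mem_Collect_eq by (rule nn_integral_add) measurable
  also have "(\<integral>\<^sup>+z. indicator {z. A \<le> snd y + ell (Suc (fst y)) z} z * g (0, lo) \<partial>G) = reset_prob y * g (0, lo)"
    unfolding reset_prob_def indicator_def mem_Collect_eq by (rule nn_integral_multc) measurable
  finally show ?thesis .
qed

lemma occ_add:
  assumes [measurable]: "f \<in> borel_measurable S" "g \<in> borel_measurable S" "y \<in> space S"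
  shows "occ (\<lambda>x. f x + g x) y = occ f y + occ g y"
  unfolding occ_def distrib_right by (rule nn_integral_add) measurable

lemma occ_cmult:
  assumes [measurable]: "f \<in> borel_measurable S" "y \<in> space S"
  shows "occ (\<lambda>x. f x * c) y = occ f y * c"
proof -
  have "occ (\<lambda>x. f x * c) y = (\<integral>\<^sup>+s. (f (flow_state y s) * ennreal (survival (snd y) s) * indicator {0..} s) * c \<partial>lborel)"
    unfolding occ_def by (simp add: mult_ac)
  also have "\<dots> = occ f y * c"
    unfolding occ_def by (rule nn_integral_multc) measurable
  finally show ?thesis .
qed

lemma occ_mono:
  assumes "\<And>x. x \<in> space S \<Longrightarrow> f x \<le> g x" and "y \<in> space S"
  shows "occ f y \<le> occ g y"
  unfolding occ_def by (intro nn_integral_mono mult_right_mono assms flow_state_in_S) auto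

lemma mark0_add:
  assumes [measurable]: "f \<in> borel_measurable S" "g \<in> borel_measurable S" "y \<in> space S"
  shows "mark0 (\<lambda>x. f x + g x) y = mark0 f y + mark0 g y"
  unfolding mark0_eq by (subst nn_integral_add[symmetric]) (auto intro!: nn_integral_cong)

lemma mark0_cmult:
  assumes [measurable]: "f \<in> borel_measurable S" "y \<in> space S"
  shows "mark0 (\<lambda>x. f x * c) y = mark0 f y * c"
  unfolding mark0_eq by (subst nn_integral_multc[symmetric]) (auto intro!: nn_integral_cong)

lemma mark0_mono:
  assumes "\<And>x. x \<in> space S \<Longrightarrow> f x \<le> g x" and "y \<in> space S"
  shows "mark0 f y \<le> mark0 g y"
  unfolding mark0_eq using assms jump_in_S[OF assms(2)] by (intro nn_integral_mono) (auto simp: space_G)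

lemma step_mono:
  assumes "\<And>x. x \<in> space S \<Longrightarrow> f x \<le> g x" and "y \<in> space S"
  shows "step f y \<le> step g y"
  unfolding step_def by (intro occ_mono mult_left_mono mark0_mono assms) auto

text \<open>Many of the identities for these kernels are available only on the state space, so they
  cannot be rewritten under \<open>step\<close> as equations between functions. Monotonicity in both
  directions replaces the rewriting.\<close>

lemma step_cong:
  assumes "\<And>x. x \<in> space S \<Longrightarrow> f x = g x" and "y \<in> space S"
  shows "step f y = step g y"
  using assms by (intro antisym step_mono) auto

lemma step_add:
  assumes [measurable]: "f \<in> borel_measurable S" "g \<in> borel_measurable S" "y \<in> space S"
  shows "step (\<lambda>x. f x + g x) y = step f y + step g y"
proof -
  have "step (\<lambda>x. f x + g x) y = occ (\<lambda>x. ennreal (snd x) * mark0 f x + ennreal (snd x) * mark0 g x) y"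
    unfolding step_def
    by (intro antisym occ_mono) (simp_all add: mark0_add distrib_left assms)
  also have "\<dots> = step f y + step g y"
    unfolding step_def by (rule occ_add) measurable
  finally show ?thesis .
qed

lemma step_cmult:
  assumes [measurable]: "f \<in> borel_measurable S" "y \<in> space S"
  shows "step (\<lambda>x. f x * c) y = step f y * c"
proof -
  have "step (\<lambda>x. f x * c) y = occ (\<lambda>x. ennreal (snd x) * mark0 f x * c) y"
    unfolding step_def
    by (intro antisym occ_mono) (simp_all only: mark0_cmult[OF assms(1)] mult.assoc order_refl assms(2))
  also have "\<dots> = step f y * c"
    unfolding step_def by (rule occ_cmult) measurable
  finally show ?thesis .
qed

lemma funpow_step_mono:
  "(\<And>x. x \<in> space S \<Longrightarrow> f x \<le> g x) \<Longrightarrow> y \<in> space S \<Longrightarrow> (step ^^ n) f y \<le> (step ^^ n) g y"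
  by (induction n arbitrary: y) (auto intro: step_mono)

lemma funpow_step_add:
  assumes [measurable]: "f \<in> borel_measurable S" "g \<in> borel_measurable S"
  shows "y \<in> space S \<Longrightarrow> (step ^^ n) (\<lambda>x. f x + g x) y = (step ^^ n) f y + (step ^^ n) g y"
proof (induction n arbitrary: y)
  case (Suc n)
  then have "step ((step ^^ n) (\<lambda>x. f x + g x)) y = step (\<lambda>x. (step ^^ n) f x + (step ^^ n) g x) y"
    by (intro step_cong) auto
  with Suc.prems show ?case by (simp add: step_add)
qed simp

lemma funpow_step_cmult:
  assumes [measurable]: "f \<in> borel_measurable S"
  shows "y \<in> space S \<Longrightarrow> (step ^^ n) (\<lambda>x. f x * c) y = (step ^^ n) f y * c"
proof (induction n arbitrary: y)
  case (Suc n)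
  then have "step ((step ^^ n) (\<lambda>x. f x * c)) y = step (\<lambda>x. (step ^^ n) f x * c) y"
    by (intro step_cong) auto
  with Suc.prems show ?case by (simp add: step_cmult)
qed simp

lemma cycle_0: "cycle_law 0 g = g (0, lo)"
  by (simp add: cycle_law_def)

text \<open>The outermost \<open>step\<close> is the first jump of the cycle and the innermost the
  last; moving one copy inside appends a jump at the end.\<close>

lemma cycle_Suc: "cycle_law (Suc n) g = cycle_law n (step g)"
  by (simp add: cycle_law_def funpow_swap1)

lemma cycle_mono: "(\<And>x. x \<in> space S \<Longrightarrow> f x \<le> g x) \<Longrightarrow> cycle_law n f \<le> cycle_law n g"
  by (simp add: cycle_law_def funpow_step_mono)

lemma cycle_cong: "(\<And>x. x \<in> space S \<Longrightarrow> f x = g x) \<Longrightarrow> cycle_law n f = cycle_law n g"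
  by (intro antisym cycle_mono) auto

lemma cycle_add:
  "f \<in> borel_measurable S \<Longrightarrow> g \<in> borel_measurable S \<Longrightarrow> cycle_law n (\<lambda>x. f x + g x) = cycle_law n f + cycle_law n g"
  by (simp add: cycle_law_def funpow_step_add)

lemma cycle_cmult: "f \<in> borel_measurable S \<Longrightarrow> cycle_law n (\<lambda>x. f x * c) = cycle_law n f * c"
  by (simp add: cycle_law_def funpow_step_cmult)

text \<open>Intensity times survival is the density of the holding time in
  \<open>nn_integral_hold\<close>.\<close>

lemma occ_hold:
  assumes y: "y \<in> space S" and [measurable]: "g \<in> borel_measurable S"
  shows "occ (\<lambda>x. ennreal (snd x) * g x) y = (\<integral>\<^sup>+e. g (flow_state y (hold (snd y) e)) \<partial>E)"
proof -
  note [measurable] = y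
  have "(\<integral>\<^sup>+e. g (flow_state y (hold (snd y) e)) \<partial>E) =
    (\<integral>\<^sup>+s\<in>{0..}. ennreal (snd (flow_state y s) * survival (snd y) s) * g (flow_state y s) \<partial>lborel)"
    by (rule nn_integral_hold[OF y]) measurable
  also have "\<dots> = occ (\<lambda>x. ennreal (snd x) * g x) y"
    unfolding occ_def
    by (intro nn_integral_cong) (simp add: ennreal_mult snd_S_pos[OF flow_state_in_S[OF y]] less_imp_le mult_ac)
  finally show ?thesis ..
qed

text \<open>The next jump comes almost surely, since \<open>occ\<close> of the intensity is one, and
  it either resets or does not.\<close>

lemma step_1_reset_step:
  assumes y: "y \<in> space S"
  shows "step (\<lambda>_. 1) y + reset_step y = 1"
proof -
  note [measurable] = y
  have m: "mark0 (\<lambda>_. 1) x + reset_prob x = 1" if "x \<in> space S" for x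
    using mark_split[OF that, of "\<lambda>_. 1"] by (simp add: mark_def G.emeasure_space_1)
  have "step (\<lambda>_. 1) y + reset_step y =
     occ (\<lambda>x. ennreal (snd x) * mark0 (\<lambda>_. 1) x + ennreal (snd x) * reset_prob x) y"
    unfolding step_def reset_step_def by (rule occ_add[symmetric]) measurable
  also have "\<dots> = occ (\<lambda>x. ennreal (snd x) * 1) y"
    by (intro antisym occ_mono y) (simp_all only: distrib_left[symmetric] m order_refl)
  also have "\<dots> = 1"
    by (subst occ_hold[OF y]) (auto simp: E.emeasure_space_1[simplified])
  finally show ?thesis .
qed

text \<open>Either one of the first \<open>N\<close> jumps resets or none does. The summand with
  index \<open>n\<close> belongs to a reset at jump \<open>n + 1\<close>.\<close>

lemma cycle_reset_sum: "(\<Sum>n<N. cycle_law n reset_step) + cycle_law N (\<lambda>_. 1) = 1"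
proof (induction N)
  case 0 then show ?case by (simp add: cycle_0)
next
  case (Suc N)
  have "cycle_law N (\<lambda>_. 1) = cycle_law N (\<lambda>y. step (\<lambda>_. 1) y + reset_step y)"
    by (rule cycle_cong) (simp add: step_1_reset_step)
  also have "\<dots> = cycle_law (Suc N) (\<lambda>_. 1) + cycle_law N reset_step"
    using reset_step_measurable[of "\<lambda>x. x"] by (simp add: cycle_add cycle_Suc)
  finally show ?case using Suc by (simp add: add_ac)
qed

lemma occ_semi_step:
  assumes y: "y \<in> space S" and t: "0 \<le> t" and [measurable]: "f \<in> borel_measurable S"
  shows "occ (semi f t) y + potential f t y =
    occ f y + (step (potential f t) y + reset_step y * potential f t (0, lo))"
proof -
  note [measurable] = y
  have pm[measurable]: "potential f t \<in> borel_measurable S"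
    using potential_measurable[of f "\<lambda>x. x" S t] by simp
  have "occ (\<lambda>x. ennreal (snd x) * mark (potential f t) x) y =
     occ (\<lambda>x. ennreal (snd x) * mark0 (potential f t) x + ennreal (snd x) * reset_prob x * potential f t (0, lo)) y"
    by (intro antisym occ_mono y) (simp_all add: mark_split distrib_left mult.assoc)
  also have "\<dots> = step (potential f t) y + reset_step y * potential f t (0, lo)"
    unfolding step_def reset_step_def
    by (subst occ_cmult[symmetric], measurable, subst occ_add, measurable)
  finally show ?thesis unfolding occ_semi[OF y t assms(3)] by simp
qed

text \<open>Applying \<open>cycle_law n\<close> to \<open>occ_semi_step\<close> produces the
  potential at \<open>n\<close> on the left and at \<open>n + 1\<close> on the right. Summing leaves
  the starting potential, the boundary term at \<open>N\<close>, and the restarts from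
  \<open>(0, lo)\<close>.\<close>

lemma cycle_telescope:
  assumes t: "0 \<le> t" and [measurable]: "f \<in> borel_measurable S"
  shows "(\<Sum>n<N. cycle_law n (occ (semi f t))) + potential f t (0, lo) =
    (\<Sum>n<N. cycle_law n (occ f)) + (cycle_law N (potential f t) + (\<Sum>n<N. cycle_law n reset_step) * potential f t (0, lo))"
proof (induction N)
  case 0 then show ?case by (simp add: cycle_0)
next
  case (Suc N)
  have [measurable]: "potential f t \<in> borel_measurable S" "semi f t \<in> borel_measurable S"
     "occ f \<in> borel_measurable S" "reset_step \<in> borel_measurable S"
    using potential_measurable[of f "\<lambda>x. x" S t] semi_measurable[of f "\<lambda>_. t" S "\<lambda>x. x"]
      occ_measurable[of f "\<lambda>x. x" S] reset_step_measurable[of "\<lambda>x. x" S] by simp_all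
  have [measurable]: "occ (semi f t) \<in> borel_measurable S"
    using occ_measurable[of "semi f t" "\<lambda>x. x" S] by simp
  have "cycle_law N (occ (semi f t)) + cycle_law N (potential f t) =
     cycle_law N (\<lambda>y. occ (semi f t) y + potential f t y)"
    by (simp add: cycle_add)
  also have "\<dots> = cycle_law N (\<lambda>y. occ f y + (step (potential f t) y + reset_step y * potential f t (0, lo)))"
    using t by (intro cycle_cong occ_semi_step) auto
  also have "\<dots> = cycle_law N (occ f) + (cycle_law (Suc N) (potential f t) + cycle_law N reset_step * potential f t (0, lo))"
    by (simp add: cycle_add cycle_cmult cycle_Suc)
  finally have *: "cycle_law N (occ (semi f t)) + cycle_law N (potential f t) = \<dots>" .
  have "(\<Sum>n<Suc N. cycle_law n (occ (semi f t))) + potential f t (0, lo) =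
     ((\<Sum>n<N. cycle_law n (occ (semi f t))) + potential f t (0, lo)) + cycle_law N (occ (semi f t))"
    by (simp add: add_ac)
  also have "\<dots> = (\<Sum>n<N. cycle_law n (occ f)) + (\<Sum>n<N. cycle_law n reset_step) * potential f t (0, lo)
     + (cycle_law N (occ (semi f t)) + cycle_law N (potential f t))"
    unfolding Suc by (simp add: add_ac)
  finally show ?case unfolding * by (simp add: add_ac distrib_right)
qed

section \<open>Recurrence\<close>

text \<open>With the numbering of \<open>pre_jump\<close>, index \<open>k\<close> speaks of jump
  number \<open>k + 1\<close>.\<close>

definition no_reset :: "nat \<times> real \<Rightarrow> (real \<times> real) stream \<Rightarrow> nat \<Rightarrow> bool" where
  "no_reset y \<omega> k \<longleftrightarrow> snd (pre_jump \<alpha> \<beta> A lo ell y \<omega> k) +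
     ell (Suc (fst (pre_jump \<alpha> \<beta> A lo ell y \<omega> k))) (snd (\<omega> !! k)) < A"

lemma pre_jump_eq:
  assumes "y \<in> space S" "\<omega> \<in> space \<Omega>"
  shows "pre_jump \<alpha> \<beta> A lo ell y \<omega> k =
    flow_state (snd (skel y \<omega> k)) (hold (snd (snd (skel y \<omega> k))) (fst (\<omega> !! k)))"
  using hold_nonneg[OF snd_S_pos[OF skel_in_S[OF assms, of k]]]
  by (simp add: pre_jump_def flow_state_def case_prod_unfold)

lemma pre_jump_Stream:
  fixes x :: "real \<times> real"
  assumes "y \<in> space S"
  shows "pre_jump \<alpha> \<beta> A lo ell y (x ## \<omega>) (Suc k) =
    pre_jump \<alpha> \<beta> A lo ell (jmp (flow_state y (hold (snd y) (fst x))) (snd x)) \<omega> k"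
  by (simp add: pre_jump_def skel_Stream[OF assms] case_prod_unfold del: skeleton.simps)

lemma no_reset_measurable [measurable]:
  assumes [measurable]: "y \<in> space S"
  shows "Measurable.pred \<Omega> (\<lambda>\<omega>. no_reset y \<omega> k)"
proof -
  have "Measurable.pred \<Omega> (\<lambda>\<omega>. no_reset y \<omega> k) \<longleftrightarrow> Measurable.pred \<Omega> (\<lambda>\<omega>.
     snd (flow_state (snd (skel y \<omega> k)) (hold (snd (snd (skel y \<omega> k))) (fst (\<omega> !! k)))) +
     ell (Suc (fst (flow_state (snd (skel y \<omega> k)) (hold (snd (snd (skel y \<omega> k))) (fst (\<omega> !! k)))))) (snd (\<omega> !! k)) < A)"
    unfolding no_reset_def by (intro measurable_cong) (simp add: pre_jump_eq[OF assms])
  moreover have "Measurable.pred \<Omega> (\<lambda>\<omega>.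
     snd (flow_state (snd (skel y \<omega> k)) (hold (snd (snd (skel y \<omega> k))) (fst (\<omega> !! k)))) +
     ell (Suc (fst (flow_state (snd (skel y \<omega> k)) (hold (snd (snd (skel y \<omega> k))) (fst (\<omega> !! k)))))) (snd (\<omega> !! k)) < A)"
    by measurable
  ultimately show ?thesis by blast
qed

text \<open>The bridge from the kernels back to sample paths, through which the finiteness of the
  reset time enters. The induction splits off the first jump, hence the generalisation over
  \<open>y\<close>: \<open>All_less_Suc2\<close> separates the head of the stream from its
  tail.\<close>

lemma funpow_step_1:
  "y \<in> space S \<Longrightarrow> (step ^^ N) (\<lambda>_. 1) y = (\<integral>\<^sup>+\<omega>. indicator {\<omega>. \<forall>k<N. no_reset y \<omega> k} \<omega> \<partial>\<Omega>)"
proof (induction N arbitrary: y)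
  case 0 then show ?case by (simp add: \<Omega>.emeasure_space_1)
next
  case (Suc N)
  note [measurable] = Suc.prems
  let ?p = "\<lambda>e. flow_state y (hold (snd y) e)"
  have p: "?p e \<in> space S" for e using Suc.prems by (rule flow_state_in_S)
  have "no_reset y ((e, z) ## \<omega>) 0 \<longleftrightarrow> snd (?p e) + ell (Suc (fst (?p e))) z < A" for e z \<omega>
    using hold_nonneg[OF snd_S_pos[OF Suc.prems], of e]
    by (simp add: no_reset_def pre_jump_def flow_state_def case_prod_unfold)
  moreover have "no_reset y ((e, z) ## \<omega>) (Suc k) \<longleftrightarrow> no_reset (jmp (?p e) z) \<omega> k" for e z \<omega> k
    by (simp add: no_reset_def pre_jump_Stream[OF Suc.prems])
  ultimately have iff: "(\<forall>k<Suc N. no_reset y ((e, z) ## \<omega>) k) \<longleftrightarrow>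
     snd (?p e) + ell (Suc (fst (?p e))) z < A \<and> (\<forall>k<N. no_reset (jmp (?p e) z) \<omega> k)" for e z \<omega>
    by (simp only: All_less_Suc2)
  have m: "Measurable.pred \<Omega> (\<lambda>\<omega>. \<forall>k<Suc N. no_reset y \<omega> k)" by measurable
  have "(\<integral>\<^sup>+\<omega>. indicator {\<omega>. \<forall>k<Suc N. no_reset y \<omega> k} \<omega> \<partial>\<Omega>) =
     (\<integral>\<^sup>+e. (\<integral>\<^sup>+z. (\<integral>\<^sup>+\<omega>. indicator {\<omega>. \<forall>k<Suc N. no_reset y \<omega> k} ((e, z) ## \<omega>) \<partial>\<Omega>) \<partial>G) \<partial>E)"
    unfolding indicator_def mem_Collect_eq by (intro nn_integral_driving) (use m in measurable)
  also have "\<dots> = (\<integral>\<^sup>+e. mark0 ((step ^^ N) (\<lambda>_. 1)) (?p e) \<partial>E)"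
    unfolding mark0_eq
  proof (intro nn_integral_cong)
    fix e z assume "z \<in> space G"
    then have "jmp (?p e) z \<in> space S" using p by (intro jump_in_S) (auto simp: space_G)
    from Suc.IH[OF this] show "(\<integral>\<^sup>+\<omega>. indicator {\<omega>. \<forall>k<Suc N. no_reset y \<omega> k} ((e, z) ## \<omega>) \<partial>\<Omega>) =
       (if snd (?p e) + ell (Suc (fst (?p e))) z < A then (step ^^ N) (\<lambda>_. 1) (jmp (?p e) z) else 0)"
      unfolding indicator_def mem_Collect_eq iff by simp
  qed
  also have "\<dots> = (step ^^ Suc N) (\<lambda>_. 1) y"
    unfolding funpow.simps comp_def step_def[of "(step ^^ N) (\<lambda>_. 1)"]
    by (rule occ_hold[symmetric, OF Suc.prems]) (use mark0_measurable[of _ "\<lambda>x. x"] in simp)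
  finally show ?case ..
qed

lemma cycle_1_tendsto:
  assumes "AE \<omega> in \<Omega>. reset_time \<alpha> \<beta> A lo ell (0, lo) \<omega> < \<infinity>"
  shows "(\<lambda>N. cycle_law N (\<lambda>_. 1)) \<longlonglongrightarrow> 0"
proof -
  let ?I = "\<lambda>N \<omega>. indicator {\<omega>. \<forall>k<N. no_reset (0, lo) \<omega> k} \<omega> :: ennreal"
  have "(\<lambda>N. \<integral>\<^sup>+\<omega>. ?I N \<omega> \<partial>\<Omega>) \<longlonglongrightarrow> (\<integral>\<^sup>+\<omega>. 0 \<partial>\<Omega>)"
  proof (rule nn_integral_dominated_convergence[where w="\<lambda>_. 1"])
    show "?I N \<in> borel_measurable \<Omega>" for N
      unfolding indicator_def mem_Collect_eq by measurable
    show "AE \<omega> in \<Omega>. (\<lambda>N. ?I N \<omega>) \<longlonglongrightarrow> 0"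
      using assms
    proof eventually_elim
      case (elim \<omega>)
      have "\<exists>k. \<not> no_reset (0, lo) \<omega> k"
      proof (rule ccontr)
        assume "\<not> ?thesis"
        \<comment> \<open>\<open>reset_time\<close> is an infimum over this set, and the infimum of
          the empty set is infinite.\<close>
        then have "{k. case pre_jump \<alpha> \<beta> A lo ell (0, lo) \<omega> k of (n, l) \<Rightarrow> A \<le> l + ell (n + 1) (snd (\<omega> !! k))} = {}"
          by (auto simp: no_reset_def case_prod_unfold not_le)
        with elim show False by (simp add: reset_time_def top_ereal_def)
      qed
      then obtain k where k: "\<not> no_reset (0, lo) \<omega> k" by blast
      have "eventually (\<lambda>N. ?I N \<omega> = 0) sequentially"
        using eventually_gt_at_top[of k] by eventually_elim (use k in \<open>auto simp: indicator_def\<close>)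
      then show ?case by (rule tendsto_eventually)
    qed
  qed (auto simp: \<Omega>.emeasure_space_1 indicator_def)
  then show ?thesis by (simp add: cycle_law_def funpow_step_1)
qed

section \<open>Finite-horizon bounds and the limit over the jumps of a cycle\<close>

lemma semi_le_1:
  assumes "\<And>x. f x \<le> 1"
  shows "semi f t y \<le> 1"
proof -
  have "semi f t y \<le> (\<integral>\<^sup>+\<omega>. 1 \<partial>\<Omega>)" unfolding semi_def by (intro nn_integral_mono assms)
  then show ?thesis by (simp add: \<Omega>.emeasure_space_1)
qed

lemma potential_le:
  assumes "\<And>x. f x \<le> 1" "0 \<le> t"
  shows "potential f t y \<le> ennreal t"
proof -
  have "potential f t y \<le> (\<integral>\<^sup>+s. indicator {0..t} s \<partial>lborel)"
    unfolding potential_def using semi_le_1[OF assms(1)]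
    by (intro nn_integral_mono) (auto simp: indicator_def)
  with assms(2) show ?thesis by simp
qed

lemma cycle_reset_tendsto:
  assumes "(\<lambda>N. cycle_law N (\<lambda>_. 1)) \<longlonglongrightarrow> 0"
  shows "(\<lambda>N. \<Sum>n<N. cycle_law n reset_step) \<longlonglongrightarrow> 1"
proof -
  have "(\<Sum>n<N. cycle_law n reset_step) = 1 - cycle_law N (\<lambda>_. 1)" for N
  proof -
    have "cycle_law N (\<lambda>_. 1) \<noteq> top"
      using cycle_reset_sum[of N] by (metis add_top_right_ennreal ennreal_one_neq_top) 
    then show ?thesis using cycle_reset_sum[of N] by (metis ennreal_add_diff_cancel_right)
  qed
  moreover have "(\<lambda>N. 1 - cycle_law N (\<lambda>_. 1)) \<longlonglongrightarrow> 1 - 0"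
    by (intro tendsto_diff_ennreal assms tendsto_const) auto
  ultimately show ?thesis by simp
qed

text \<open>In the telescoped identity the boundary term is at most \<open>t\<close> times the
  probability of no reset among \<open>N\<close> jumps, so it vanishes, while the reset
  probabilities add up to one. What remains is the same potential at \<open>(0, lo)\<close> on both
  sides; \<open>f \<le> 1\<close> makes it finite and so cancellable, even when the two series
  diverge.\<close>

lemma cycle_sum_invariant:
  assumes rec: "(\<lambda>N. cycle_law N (\<lambda>_. 1)) \<longlonglongrightarrow> 0"
    and t: "0 \<le> t" and [measurable]: "f \<in> borel_measurable S" and f: "\<And>x. f x \<le> 1"
  shows "(\<Sum>n. cycle_law n (occ (semi f t))) = (\<Sum>n. cycle_law n (occ f))"
proof -
  let ?U = "potential f t (0, lo)"
  have U: "?U \<noteq> top" using potential_le[of f t "(0, lo)"] f t by (auto simp: top_unique)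
  have le: "cycle_law N (potential f t) \<le> cycle_law N (\<lambda>_. 1) * ennreal t" for N
    using cycle_mono[of "potential f t" "\<lambda>x. 1 * ennreal t" N] potential_le[OF f t]
      cycle_cmult[of "\<lambda>_. 1" N "ennreal t"] by simp
  have "(\<lambda>N. cycle_law N (\<lambda>_. 1) * ennreal t) \<longlonglongrightarrow> 0 * ennreal t"
    by (intro tendsto_mult_ennreal rec tendsto_const) auto
  then have lim: "(\<lambda>N. cycle_law N (\<lambda>_. 1) * ennreal t) \<longlonglongrightarrow> 0" by simp
  have 1: "(\<lambda>N. cycle_law N (potential f t)) \<longlonglongrightarrow> 0"
    by (rule tendsto_sandwich[OF _ _ tendsto_const lim]) (simp_all add: le)
  have 2: "(\<lambda>N. (\<Sum>n<N. cycle_law n reset_step) * ?U) \<longlonglongrightarrow> 1 * ?U"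
    using U by (intro tendsto_mult_ennreal cycle_reset_tendsto rec tendsto_const) auto
  have "(\<lambda>N. (\<Sum>n<N. cycle_law n (occ f)) + (cycle_law N (potential f t) + (\<Sum>n<N. cycle_law n reset_step) * ?U))
     \<longlonglongrightarrow> (\<Sum>n. cycle_law n (occ f)) + (0 + 1 * ?U)"
    by (intro tendsto_add 1 2 summable_LIMSEQ) auto
  moreover have "(\<lambda>N. (\<Sum>n<N. cycle_law n (occ (semi f t))) + ?U) \<longlonglongrightarrow> (\<Sum>n. cycle_law n (occ (semi f t))) + ?U"
    by (intro tendsto_add summable_LIMSEQ) auto
  ultimately have "(\<Sum>n. cycle_law n (occ (semi f t))) + ?U = (\<Sum>n. cycle_law n (occ f)) + ?U"
    unfolding cycle_telescope[OF t assms(3)] by (simp add: LIMSEQ_unique)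
  with U show ?thesis by (metis ennreal_add_diff_cancel_right)
qed

section \<open>The occupation measure as a density\<close>

abbreviation "F \<equiv> integrating_factor \<alpha> \<beta>"

lemma F_nonneg [simp]: "0 \<le> F x"
  by (simp add: integrating_factor_def)

lemma F_measurable [measurable]: "F \<in> borel_measurable borel"
  unfolding integrating_factor_def by measurable

text \<open>The second factor is the speed of the flow at time \<open>s\<close>, so the first is the
  occupation density at the point reached. \<open>F\<close> is what separates this density into a
  factor of the start and a factor of that point.\<close>

lemma survival_eq_F:
  assumes "l \<noteq> \<beta>"
  shows "F l / (F (flow \<alpha> \<beta> l s) * (\<alpha> * \<bar>l - \<beta>\<bar>)) * (\<bar>l - \<beta>\<bar> * (\<alpha> * exp (- \<alpha> * s))) = survival l s"
proof -
  let ?c = "(\<alpha> - \<beta>) / \<alpha>" let ?x = "flow \<alpha> \<beta> l s"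
  have "\<bar>?x - \<beta>\<bar> = \<bar>l - \<beta>\<bar> * exp (- \<alpha> * s)"
    by (simp add: flow_def abs_mult)
  then have "F ?x = exp (- ?x / \<alpha>) * (\<bar>l - \<beta>\<bar> powr ?c * exp (- s * (\<alpha> - \<beta>)))"
    using \<alpha> assms by (simp add: integrating_factor_def powr_mult exp_powr_real)
  then have "F l / (F ?x * (\<alpha> * \<bar>l - \<beta>\<bar>)) * (\<bar>l - \<beta>\<bar> * (\<alpha> * exp (- \<alpha> * s))) =
      exp (- l / \<alpha>) / (exp (- ?x / \<alpha>) * exp (- s * (\<alpha> - \<beta>))) * exp (- \<alpha> * s)"
    using \<alpha> assms by (simp add: integrating_factor_def)
  also have "\<dots> = exp (- l / \<alpha> - (- ?x / \<alpha> + - s * (\<alpha> - \<beta>)) + (- \<alpha> * s))"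
    by (simp only: exp_add exp_diff)
  also have "- l / \<alpha> - (- ?x / \<alpha> + - s * (\<alpha> - \<beta>)) + (- \<alpha> * s) = - hazard l s"
    using \<alpha> by (simp add: hazard_def flow_def field_simps)
  finally show ?thesis by (simp add: survival_def)
qed

text \<open>Test functions are measurable only on the state space; cutting off by the indicator
  extends a slice by zero to the line, where Lebesgue integrals and shifts are available.\<close>

lemma slice_measurable [measurable (raw)]:
  fixes f :: "nat \<times> real \<Rightarrow> ennreal"
  assumes [measurable]: "f \<in> borel_measurable S" and k[measurable]: "k \<in> borel_measurable M"
  shows "(\<lambda>x. f (n, k x) * indicator {lo..<A} (k x)) \<in> borel_measurable M"
proof -
  have "(\<lambda>x. f (n, x)) \<in> borel_measurable (restrict_space borel {lo..<A})"
  proof (rule measurable_compose[OF _ assms(1)], rule measurable_Pair_S)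
    show "(\<lambda>x. x) \<in> borel_measurable (restrict_space borel {lo..<A})"
      by (rule measurable_restrict_space1) simp
  qed (auto simp: space_S space_restrict_space)
  then have "(\<lambda>x. f (n, x) * indicator {lo..<A} x) \<in> borel_measurable borel"
    using borel_measurable_restrict_space_iff_ennreal[of "{lo..<A}" borel "\<lambda>x. f (n, x)"] by simp
  from measurable_compose[OF k this] show ?thesis .
qed

text \<open>The Green density of the killed flow: expected time spent near \<open>x\<close> by the
  flow from \<open>y\<close> before the next jump. The intervals contain \<open>y\<close> but not
  \<beta>, which is approached and never reached. For \<open>y = \<beta>\<close> the value is zero
  and does not describe the resting flow.\<close>

definition occ_density :: "real \<Rightarrow> real \<Rightarrow> ennreal" where
  "occ_density y x = ennreal (F y / (F x * (\<alpha> * \<bar>y - \<beta>\<bar>))) *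
     indicator (if y < \<beta> then {y..<\<beta>} else {\<beta><..y}) x"

lemma occ_density_measurable [measurable (raw)]:
  assumes [measurable]: "f \<in> borel_measurable M" "g \<in> borel_measurable M"
  shows "(\<lambda>x. occ_density (f x) (g x)) \<in> borel_measurable M"
proof -
  have "(\<lambda>x. occ_density (f x) (g x)) = (\<lambda>x. ennreal (F (f x) / (F (g x) * (\<alpha> * \<bar>f x - \<beta>\<bar>))) *
     (if f x < \<beta> then if f x \<le> g x \<and> g x < \<beta> then 1 else 0 else if \<beta> < g x \<and> g x \<le> f x then 1 else 0))"
    by (auto simp: occ_density_def indicator_def fun_eq_iff)
  then show ?thesis by simp
qed

lemma occ_eq_density:
  assumes l: "(n, l) \<in> space S" "l \<noteq> \<beta>" and [measurable]: "f \<in> borel_measurable S"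
  shows "occ f (n, l) = (\<integral>\<^sup>+x\<in>{lo..<A}. f (n, x) * occ_density l x \<partial>lborel)"
proof -
  \<comment> \<open>The flow rises below \<beta> and falls above it. With the sign
    \<open>\<sigma>\<close> and \<open>x = \<beta> + \<sigma> * v\<close>, both cases become the
    increasing motion \<open>w\<close> from \<open>- d\<close> towards zero.\<close>
  define \<sigma> :: real where "\<sigma> = (if l < \<beta> then 1 else - 1)"
  define d where "d = \<bar>l - \<beta>\<bar>"
  have d: "0 < d" and \<sigma>: "l = \<beta> - \<sigma> * d" "\<sigma> \<noteq> 0" "\<bar>\<sigma>\<bar> = 1" using l by (auto simp: d_def \<sigma>_def)
  define w where "w s = - d * exp (- \<alpha> * s)" for s
  define h where "h v = (f (n, \<beta> + \<sigma> * v) * indicator {lo..<A} (\<beta> + \<sigma> * v)) *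
     ennreal (F l / (F (\<beta> + \<sigma> * v) * (\<alpha> * d)))" for v
  have [measurable]: "h \<in> borel_measurable borel" unfolding h_def by measurable
  have flow: "flow \<alpha> \<beta> l s = \<beta> + \<sigma> * w s" for s
    using \<sigma>(1) by (simp add: flow_def w_def)
  have rng: "(\<Union>n::nat. {w 0..w (real (Suc n))}) = {- d..<0}"
  proof (intro equalityI subsetI)
    fix x assume x: "x \<in> {- d..<0}"
    \<comment> \<open>\<open>ln (d / (- x)) / \<alpha>\<close> is the time at which \<open>w\<close>
      passes \<open>x\<close>.\<close>
    obtain m where m: "ln (d / (- x)) / \<alpha> \<le> real m" using real_arch_simple by blast
    have "ln (d / (- x)) \<le> \<alpha> * real (Suc m)"
      using m \<alpha> by (simp add: field_simps)
    then have "exp (ln (d / (- x))) \<le> exp (\<alpha> * real (Suc m))" by simp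
    then have "d / (- x) \<le> exp (\<alpha> * real (Suc m))"
      using x d by (subst (asm) exp_ln) (auto intro: divide_pos_neg)
    moreover define e where "e = exp (\<alpha> * real (Suc m))"
    ultimately have le: "d / (- x) \<le> e" by (simp only: e_def)
    have e: "w (real (Suc m)) = - d / e" "0 < e"
      unfolding w_def e_def by (simp_all add: exp_minus divide_inverse)
    have "x \<le> w (real (Suc m))"
      unfolding e(1) using le e(2) x d by (simp add: field_simps)
    then show "x \<in> (\<Union>n::nat. {w 0..w (real (Suc n))})"
      using x by (intro UN_I[of m]) (auto simp: w_def)
  qed (use d in \<open>auto simp: w_def intro: le_less_trans\<close>)
  have "occ f (n, l) = (\<integral>\<^sup>+s. h (w s) * ennreal (d * (\<alpha> * exp (- \<alpha> * s))) * indicator {0..} s \<partial>lborel)"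
    unfolding occ_def
  proof (rule nn_integral_cong)
    fix s :: real
    show "f (flow_state (n, l) s) * ennreal (survival (snd (n, l)) s) * indicator {0..} s =
      h (w s) * ennreal (d * (\<alpha> * exp (- \<alpha> * s))) * indicator {0..} s"
    proof (cases "0 \<le> s")
      case True
      have "lo \<le> flow \<alpha> \<beta> l s" "flow \<alpha> \<beta> l s < A"
        using flow_state_in_S[OF l(1), of s] True by (auto simp: space_S flow_state_def)
      moreover have "ennreal (survival l s) = ennreal (F l / (F (flow \<alpha> \<beta> l s) * (\<alpha> * d))) * ennreal (d * (\<alpha> * exp (- \<alpha> * s)))"
        unfolding survival_eq_F[OF l(2), of s, symmetric] d_def using \<alpha>
        by (intro ennreal_mult) auto
      ultimately show ?thesis
        using True by (simp add: h_def flow_state_def flow[symmetric] mult_ac)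
    qed simp
  qed
  also have "\<dots> = (\<integral>\<^sup>+v. h v * indicator {- d..<0} v \<partial>lborel)"
  proof (rule nn_integral_substitution_halfline[of h w "\<lambda>s. d * (\<alpha> * exp (- \<alpha> * s))", unfolded rng])
    show "(w has_real_derivative d * (\<alpha> * exp (- \<alpha> * x))) (at x)" for x
      unfolding w_def by (auto intro!: derivative_eq_intros)
    show "continuous_on UNIV (\<lambda>s. d * (\<alpha> * exp (- \<alpha> * s)))" by (intro continuous_intros)
    show "0 \<le> d * (\<alpha> * exp (- \<alpha> * x))" for x using d \<alpha> by simp
  qed simp
  also have "\<dots> = (\<integral>\<^sup>+x\<in>{lo..<A}. f (n, x) * occ_density l x \<partial>lborel)"
  proof -
    have "(\<integral>\<^sup>+x\<in>{lo..<A}. f (n, x) * occ_density l x \<partial>lborel) =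
        (\<integral>\<^sup>+x. (f (n, x) * indicator {lo..<A} x) * occ_density l x \<partial>lborel)"
      by (simp add: mult_ac)
    also have "\<dots> = (\<integral>\<^sup>+v. (f (n, \<beta> + \<sigma> * v) * indicator {lo..<A} (\<beta> + \<sigma> * v)) * occ_density l (\<beta> + \<sigma> * v) \<partial>lborel)"
      by (subst nn_integral_real_affine[OF _ \<sigma>(2), of _ \<beta>]) (simp_all add: \<sigma>(3))
    also have "\<dots> = (\<integral>\<^sup>+v. h v * indicator {- d..<0} v \<partial>lborel)"
      unfolding h_def occ_density_def d_def \<sigma>_def using l(2)
      by (intro nn_integral_cong) (auto simp: indicator_def mult_ac)
    finally show ?thesis ..
  qed
  finally show ?thesis .
qed

section \<open>The invariant density\<close>

context
  fixes K0 :: real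
  assumes K0: "0 < K0"
begin

abbreviation "\<rho> \<equiv> inv_density \<alpha> \<beta> A lo G ell K0"
abbreviation "p n \<equiv> inflow lo G ell n (\<rho> n)"
abbreviation "J n \<equiv> jump_law G ell (Suc n)"

lemma prob_space_J: "prob_space (J n)"
  unfolding jump_law_def by (rule G.prob_space_distr) measurable

lemma sets_J [measurable_cong, simp]: "sets (J n) = sets borel"
  by (simp add: jump_law_def)

lemma AE_J_pos: "AE u in J n. 0 < u"
  unfolding jump_law_def by (subst AE_distr_iff) (auto simp: space_G ell_pos)

lemma inflow_measurable [measurable]:
  assumes [measurable]: "f \<in> borel_measurable borel"
  shows "inflow lo G ell n f \<in> borel_measurable borel"
proof -
  interpret J: prob_space "J n" by (rule prob_space_J)
  have "(\<lambda>l. \<integral>\<^sup>+u. (if u + lo < l then 1 else 0) * ennreal (l - u) * f (l - u) \<partial>J n) \<in> borel_measurable borel"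
    by measurable
  moreover have "inflow lo G ell n f = (\<lambda>l. \<integral>\<^sup>+u. (if u + lo < l then 1 else 0) * ennreal (l - u) * f (l - u) \<partial>J n)"
    by (auto simp: inflow_def fun_eq_iff indicator_def intro!: nn_integral_cong)
  ultimately show ?thesis by simp
qed

lemma density_measurable [measurable]: "\<rho> n \<in> borel_measurable borel"
proof (induction n)
  case 0 show ?case by simp
next
  case (Suc n)
  note [measurable] = inflow_measurable[OF Suc, of n]
  show ?case unfolding inv_density.simps
    by measurable
qed

text \<open>A cycle starts exactly at \<open>lo\<close>, so slice zero is the occupation density of
  a single trajectory; the stated formula is \<open>F lo / F x\<close> with the powers and
  exponentials collected.\<close>

lemma density_0:
  assumes "lo \<le> x"
  shows "\<rho> 0 x = ennreal K0 * occ_density lo x"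
proof (cases "x < \<beta>")
  case True
  let ?c = "(\<alpha> - \<beta>) / \<alpha>"
  have "(\<beta> - \<alpha>) / \<alpha> = - ?c" using minus_divide_left[of "\<alpha> - \<beta>" \<alpha>] by simp
  then have "((\<beta> - x) / (\<beta> - lo)) powr ((\<beta> - \<alpha>) / \<alpha>) = (\<beta> - lo) powr ?c / (\<beta> - x) powr ?c"
    using True lo by (simp add: powr_divide powr_minus_divide)
  moreover have "exp ((x - lo) / \<alpha>) = exp (- lo / \<alpha>) / exp (- x / \<alpha>)"
    by (simp add: exp_diff[symmetric] diff_divide_distrib)
  moreover have "\<bar>lo - \<beta>\<bar> = \<beta> - lo" "\<bar>x - \<beta>\<bar> = \<beta> - x" using True lo by auto
  ultimately have "K0 / (\<alpha> * (\<beta> - lo)) * ((\<beta> - x) / (\<beta> - lo)) powr ((\<beta> - \<alpha>) / \<alpha>) * exp ((x - lo) / \<alpha>) =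
     K0 * (F lo / (F x * (\<alpha> * \<bar>lo - \<beta>\<bar>)))"
    by (simp add: integrating_factor_def mult_ac)
  then show ?thesis using True assms lo K0 \<alpha>
    by (simp add: occ_density_def ennreal_mult[symmetric])
qed (use lo in \<open>auto simp: occ_density_def\<close>)

text \<open>Below \<beta> the point \<open>x\<close> is reached from the starts
  \<open>y \<le> x\<close>, above \<beta> from the starts \<open>y \<ge> x\<close>. The intervals in
  \<open>occ_density\<close> encode both, which gives the two cases one kernel and makes a single
  use of Fubini possible later.\<close>

lemma density_Suc:
  assumes x: "lo \<le> x" "x < A"
  shows "\<rho> (Suc n) x = (\<integral>\<^sup>+y\<in>{lo..<A}. occ_density y x * p n y \<partial>lborel)"
proof (cases "x < \<beta>")
  case True
  have "\<rho> (Suc n) x = ennreal (1 / F x) * (\<integral>\<^sup>+ y\<in>{lo..x}. ennreal (F y / (\<alpha> * (\<beta> - y))) * p n y \<partial>lborel)"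
    using True by simp
  also have "\<dots> = (\<integral>\<^sup>+ y. ennreal (1 / F x) * (ennreal (F y / (\<alpha> * (\<beta> - y))) * p n y * indicator {lo..x} y) \<partial>lborel)"
    by (rule nn_integral_cmult[symmetric]) measurable
  also have "\<dots> = (\<integral>\<^sup>+y\<in>{lo..<A}. occ_density y x * p n y \<partial>lborel)"
  proof (rule nn_integral_cong)
    fix y
    have "ennreal (1 / F x) * ennreal (F y / (\<alpha> * (\<beta> - y))) = ennreal (F y / (F x * (\<alpha> * \<bar>y - \<beta>\<bar>)))" if "y \<le> x"
      using that True \<alpha> by (simp add: ennreal_mult[symmetric])
    then show "ennreal (1 / F x) * (ennreal (F y / (\<alpha> * (\<beta> - y))) * p n y * indicator {lo..x} y) =
        occ_density y x * p n y * indicator {lo..<A} y"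
      using True x by (auto simp: occ_density_def indicator_def mult.assoc[symmetric])
  qed
  finally show ?thesis .
next
  case False
  have "\<rho> (Suc n) x = ennreal (1 / F x) * (\<integral>\<^sup>+ y\<in>{x..A}. ennreal (F y / (\<alpha> * (y - \<beta>))) * p n y \<partial>lborel)"
    using False by simp
  also have "\<dots> = (\<integral>\<^sup>+ y. ennreal (1 / F x) * (ennreal (F y / (\<alpha> * (y - \<beta>))) * p n y * indicator {x..A} y) \<partial>lborel)"
    by (rule nn_integral_cmult[symmetric]) measurable
  also have "\<dots> = (\<integral>\<^sup>+y\<in>{lo..<A}. occ_density y x * p n y \<partial>lborel)"
  proof (rule nn_integral_cong_AE)
    \<comment> \<open>The ranges differ at the null endpoint \<open>y = A\<close>.\<close>
    show "AE y in lborel. ennreal (1 / F x) * (ennreal (F y / (\<alpha> * (y - \<beta>))) * p n y * indicator {x..A} y) =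
        occ_density y x * p n y * indicator {lo..<A} y"
      using AE_lborel_singleton[of A]
    proof eventually_elim
      case (elim y)
      have "ennreal (1 / F x) * ennreal (F y / (\<alpha> * (y - \<beta>))) = ennreal (F y / (F x * (\<alpha> * \<bar>y - \<beta>\<bar>)))" if "x \<le> y"
        using that False \<alpha> by (simp add: ennreal_mult[symmetric])
      \<comment> \<open>At \<open>x = \<beta>\<close> both sides vanish: division by zero gives
        \<open>1 / F x = 0\<close>, and no interval of \<open>occ_density\<close> contains
        \<beta>.\<close>
      moreover have "F x = 0" if "x = \<beta>" using that by (simp add: integrating_factor_def)
      ultimately show ?case
        using False x elim by (auto simp: occ_density_def indicator_def mult.assoc[symmetric])
    qed
  qed
  finally show ?thesis .
qed

lemma mark0_eq_J:
  assumes x: "(n, x) \<in> space S" and [measurable]: "g \<in> borel_measurable S"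
  shows "mark0 g (n, x) = (\<integral>\<^sup>+u. g (Suc n, x + u) * indicator {lo..<A} (x + u) \<partial>J n)"
proof -
  have "(\<integral>\<^sup>+u. g (Suc n, x + u) * indicator {lo..<A} (x + u) \<partial>J n) =
     (\<integral>\<^sup>+z. g (Suc n, x + ell (Suc n) z) * indicator {lo..<A} (x + ell (Suc n) z) \<partial>G)"
    unfolding jump_law_def by (rule nn_integral_distr) measurable
  also have "\<dots> = mark0 g (n, x)"
    unfolding mark0_def using x ell_pos[of "Suc n"]
    by (intro nn_integral_cong) (auto simp: space_S space_G indicator_def add_increasing2 less_imp_le)
  finally show ?thesis ..
qed

text \<open>The state just before the jump has density proportional to
  \<open>x * \<rho> n x\<close>; adding an independent variable of law \<open>J n\<close> convolves
  it, and the shift \<open>v = x + u\<close> turns the result into \<open>p n\<close>.\<close>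

lemma cycle_Suc_inflow:
  assumes A: "\<And>f. f \<in> borel_measurable S \<Longrightarrow>
      ennreal K0 * cycle_law n (occ f) = (\<integral>\<^sup>+x\<in>{lo..<A}. f (n, x) * \<rho> n x \<partial>lborel)"
    and [measurable]: "g \<in> borel_measurable S"
  shows "ennreal K0 * cycle_law (Suc n) g = (\<integral>\<^sup>+x\<in>{lo..<A}. g (Suc n, x) * p n x \<partial>lborel)"
proof -
  interpret J: prob_space "J n" by (rule prob_space_J)
  interpret JL: pair_sigma_finite "J n" lborel ..
  define g0 where "g0 v = g (Suc n, v) * indicator {lo..<A} v" for v
  have [measurable]: "g0 \<in> borel_measurable borel" unfolding g0_def by measurable
  \<comment> \<open>The strict inequality \<open>lo < x\<close> matches the strict one in
    \<open>inflow\<close>; the point \<open>lo\<close> is null.\<close>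
  define q where "q x = ennreal x * \<rho> n x * (if lo < x \<and> x < A then 1 else 0)" for x
  have [measurable]: "q \<in> borel_measurable borel" unfolding q_def by measurable
  have "ennreal K0 * cycle_law (Suc n) g = (\<integral>\<^sup>+x\<in>{lo..<A}. ennreal x * mark0 g (n, x) * \<rho> n x \<partial>lborel)"
    unfolding cycle_Suc step_def using mark0_measurable[of g "\<lambda>x. x" S] by (subst A) simp_all
  also have "\<dots> = (\<integral>\<^sup>+x. q x * (\<integral>\<^sup>+u. g0 (x + u) \<partial>J n) \<partial>lborel)"
  proof (rule nn_integral_cong_AE)
    show "AE x in lborel. ennreal x * mark0 g (n, x) * \<rho> n x * indicator {lo..<A} x =
       q x * (\<integral>\<^sup>+u. g0 (x + u) \<partial>J n)"
      using AE_lborel_singleton[of lo]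
      by eventually_elim (auto simp: q_def g0_def mark0_eq_J space_S indicator_def mult_ac)
  qed
  also have "\<dots> = (\<integral>\<^sup>+x. (\<integral>\<^sup>+u. q x * g0 (x + u) \<partial>J n) \<partial>lborel)"
    by (intro nn_integral_cong nn_integral_cmult[symmetric]) measurable
  also have "\<dots> = (\<integral>\<^sup>+u. (\<integral>\<^sup>+x. q x * g0 (x + u) \<partial>lborel) \<partial>J n)"
    by (rule JL.Fubini') measurable
  also have "\<dots> = (\<integral>\<^sup>+u. (\<integral>\<^sup>+v. q (v - u) * g0 v \<partial>lborel) \<partial>J n)"
  proof (rule nn_integral_cong)
    fix u
    show "(\<integral>\<^sup>+x. q x * g0 (x + u) \<partial>lborel) = (\<integral>\<^sup>+v. q (v - u) * g0 v \<partial>lborel)"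
      by (subst nn_integral_real_affine[where c=1 and t="- u"]) simp_all
  qed
  also have "\<dots> = (\<integral>\<^sup>+v. (\<integral>\<^sup>+u. q (v - u) * g0 v \<partial>J n) \<partial>lborel)"
    by (rule JL.Fubini'[symmetric]) measurable
  also have "\<dots> = (\<integral>\<^sup>+x\<in>{lo..<A}. g (Suc n, x) * p n x \<partial>lborel)"
  proof (rule nn_integral_cong)
    fix v
    have "(\<integral>\<^sup>+u. q (v - u) * g0 v \<partial>J n) = (\<integral>\<^sup>+u. (indicator {u. u + lo < v} u * ennreal (v - u) * \<rho> n (v - u)) * g0 v \<partial>J n)"
    proof (rule nn_integral_cong_AE)
      \<comment> \<open>\<open>inflow\<close> does not ask for \<open>v - u < A\<close>; this
        follows from \<open>v < A\<close> and the positivity of the jump \<open>u\<close>.\<close>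
      show "AE u in J n. q (v - u) * g0 v = (indicator {u. u + lo < v} u * ennreal (v - u) * \<rho> n (v - u)) * g0 v"
        using AE_J_pos by eventually_elim (auto simp: q_def g0_def indicator_def)
    qed
    also have "\<dots> = p n v * g0 v"
      unfolding inflow_def Suc_eq_plus1[symmetric] by (rule nn_integral_multc) measurable
    finally show "(\<integral>\<^sup>+u. q (v - u) * g0 v \<partial>J n) = g (Suc n, v) * p n v * indicator {lo..<A} v"
      by (simp add: g0_def mult_ac)
  qed
  finally show ?thesis .
qed

text \<open>The post-jump density \<open>p n\<close> integrated against the kernel
  \<open>occ_density\<close> gives the next slice. In the base case the start is a point mass, for
  which \<open>lo \<noteq> \<beta>\<close> is essential.\<close>

lemma cycle_occ_density:
  "f \<in> borel_measurable S \<Longrightarrow>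
    ennreal K0 * cycle_law n (occ f) = (\<integral>\<^sup>+x\<in>{lo..<A}. f (n, x) * \<rho> n x \<partial>lborel)"
proof (induction n arbitrary: f)
  case 0
  note [measurable] = 0
  have "ennreal K0 * cycle_law 0 (occ f) = ennreal K0 * (\<integral>\<^sup>+x. (f (0, x) * indicator {lo..<A} x) * occ_density lo x \<partial>lborel)"
    using lo by (simp add: cycle_0 occ_eq_density 0 mult_ac)
  also have "\<dots> = (\<integral>\<^sup>+x. ennreal K0 * ((f (0, x) * indicator {lo..<A} x) * occ_density lo x) \<partial>lborel)"
    by (rule nn_integral_cmult[symmetric]) measurable
  also have "\<dots> = (\<integral>\<^sup>+x\<in>{lo..<A}. f (0, x) * \<rho> 0 x \<partial>lborel)"
    by (intro nn_integral_cong) (auto simp: density_0 indicator_def mult_ac simp del: inv_density.simps)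
  finally show ?case .
next
  case (Suc n)
  note [measurable] = Suc.prems
  have occ: "occ f \<in> borel_measurable S" using occ_measurable[OF Suc.prems, of "\<lambda>x. x" S] by simp
  note [measurable] = inflow_measurable[OF density_measurable[of n], of n]
  have "ennreal K0 * cycle_law (Suc n) (occ f) = (\<integral>\<^sup>+y\<in>{lo..<A}. occ f (Suc n, y) * p n y \<partial>lborel)"
    by (rule cycle_Suc_inflow[OF Suc.IH occ])
  also have "\<dots> = (\<integral>\<^sup>+y. (\<integral>\<^sup>+x. ((f (Suc n, x) * indicator {lo..<A} x) * occ_density y x) * (p n y * indicator {lo..<A} y) \<partial>lborel) \<partial>lborel)"
  proof (rule nn_integral_cong_AE)
    show "AE y in lborel. occ f (Suc n, y) * p n y * indicator {lo..<A} y =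
      (\<integral>\<^sup>+x. ((f (Suc n, x) * indicator {lo..<A} x) * occ_density y x) * (p n y * indicator {lo..<A} y) \<partial>lborel)"
      using AE_lborel_singleton[of \<beta>]
    proof eventually_elim
      case (elim y)
      show ?case
      proof (cases "y \<in> {lo..<A}")
        case True
        then have "(Suc n, y) \<in> space S" by (simp add: space_S)
        from occ_eq_density[OF this elim Suc.prems] show ?thesis
          by (subst nn_integral_multc, measurable) (simp add: mult_ac)
      qed simp
    qed
  qed
  also have "\<dots> = (\<integral>\<^sup>+x. (\<integral>\<^sup>+y. ((f (Suc n, x) * indicator {lo..<A} x) * occ_density y x) * (p n y * indicator {lo..<A} y) \<partial>lborel) \<partial>lborel)"
    by (rule lborel_pair.Fubini') measurable
  also have "\<dots> = (\<integral>\<^sup>+x\<in>{lo..<A}. f (Suc n, x) * \<rho> (Suc n) x \<partial>lborel)"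
  proof (rule nn_integral_cong)
    fix x
    have "(\<integral>\<^sup>+y. ((f (Suc n, x) * indicator {lo..<A} x) * occ_density y x) * (p n y * indicator {lo..<A} y) \<partial>lborel) =
      (f (Suc n, x) * indicator {lo..<A} x) * (\<integral>\<^sup>+y\<in>{lo..<A}. occ_density y x * p n y \<partial>lborel)"
      unfolding mult.assoc[of "f (Suc n, x) * indicator {lo..<A} x"]
      by (subst nn_integral_cmult, measurable) (simp add: mult_ac)
    then show "(\<integral>\<^sup>+y. ((f (Suc n, x) * indicator {lo..<A} x) * occ_density y x) * (p n y * indicator {lo..<A} y) \<partial>lborel) =
      f (Suc n, x) * \<rho> (Suc n) x * indicator {lo..<A} x"
      by (auto simp: density_Suc indicator_def simp del: inv_density.simps)
  qed
  finally show ?case .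
qed

end

section \<open>Invariance\<close>

lemma emeasure_transition:
  assumes y: "y \<in> space S" and t: "0 \<le> t" and B: "B \<in> sets S"
  shows "emeasure (transition \<alpha> \<beta> A lo G ell t y) B = semi (indicator B) t y"
proof -
  note [measurable] = y B
  have m: "(\<lambda>\<omega>. pth y \<omega> t) \<in> \<Omega> \<rightarrow>\<^sub>M S"
    using path_measurable[of "\<lambda>_. y" \<Omega> "\<lambda>\<omega>. \<omega>" "\<lambda>_. t"] t by (simp add: max_def)
  have "emeasure (transition \<alpha> \<beta> A lo G ell t y) B = (\<integral>\<^sup>+x. indicator B x \<partial>distr \<Omega> S (\<lambda>\<omega>. pth y \<omega> t))"
    unfolding transition_def by simp
  also have "\<dots> = (\<integral>\<^sup>+\<omega>. indicator B (pth y \<omega> t) \<partial>\<Omega>)"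
    by (rule nn_integral_distr[OF m]) measurable
  finally show ?thesis using t by (simp add: semi_def max_def)
qed

text \<open>A jump that lands exactly on \<open>A\<close> resets too, hence the left limit of the
  tail.\<close>

lemma reset_prob_eq:
  "ennreal (snd y) * reset_prob y = ennreal (snd y * jump_tail_left G ell (fst y + 1) (A - snd y))"
  if "y \<in> space S" for y
proof -
  have [measurable]: "Measurable.pred G (\<lambda>z. A - snd y \<le> ell (Suc (fst y)) z)" by measurable
  have "reset_prob y = (\<integral>\<^sup>+z. indicator {z \<in> space G. A - snd y \<le> ell (Suc (fst y)) z} z \<partial>G)"
    unfolding reset_prob_def by (intro nn_integral_cong) (auto simp: indicator_def)
  also have "\<dots> = emeasure G {z \<in> space G. A - snd y \<le> ell (Suc (fst y)) z}"
    by (rule nn_integral_indicator) measurable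
  also have "\<dots> = ennreal (jump_tail_left G ell (fst y + 1) (A - snd y))"
    by (simp add: jump_tail_left_eq prob_G G.emeasure_eq_measure)
  finally show ?thesis
    using snd_S_pos[OF that] by (simp add: ennreal_mult' less_imp_le)
qed

context
  fixes K0 :: real
  assumes K0: "0 < K0"
begin

abbreviation "\<mu> \<equiv> inv_measure \<alpha> \<beta> A lo G ell K0"

lemma sets_inv_measure [measurable_cong]: "sets \<mu> = sets S"
  unfolding inv_measure_def state_space_def sets_density
  by (intro sets_pair_measure_cong sets_restrict_space_cong refl) simp

text \<open>Identifies the measure given by the explicit densities with \<open>K0\<close> times the
  occupation measure of one cycle, so that statements about cycles apply to it.\<close>

lemma nn_integral_inv_measure:
  assumes [measurable]: "f \<in> borel_measurable S"
  shows "(\<integral>\<^sup>+y. f y \<partial>\<mu>) = ennreal K0 * (\<Sum>n. cycle_law n (occ f))"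
proof -
  note [measurable] = density_measurable[OF K0]
  let ?R = "restrict_space lborel {lo..<A}"
  interpret R: sigma_finite_measure ?R
    by (rule sigma_finite_measure_restrict_space) (auto intro: sigma_finite_lborel)
  have sets: "sets (count_space UNIV \<Otimes>\<^sub>M ?R) = sets S"
    unfolding state_space_def by (intro sets_pair_measure_cong sets_restrict_space_cong refl) simp
  have f: "f \<in> borel_measurable (count_space UNIV \<Otimes>\<^sub>M ?R)"
    using assms by (simp add: measurable_cong_sets[OF sets refl])
  have d: "(\<lambda>(n, l). inv_density \<alpha> \<beta> A lo G ell K0 n l) \<in> borel_measurable (count_space UNIV \<Otimes>\<^sub>M ?R)"
    unfolding case_prod_unfold
    by (rule measurable_compose_countable[of "\<lambda>n x. inv_density \<alpha> \<beta> A lo G ell K0 n (snd x)"])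
       (auto intro!: measurable_compose[OF measurable_snd] measurable_restrict_space1)
  have "(\<integral>\<^sup>+y. f y \<partial>\<mu>) = (\<integral>\<^sup>+y. (case y of (n, l) \<Rightarrow> inv_density \<alpha> \<beta> A lo G ell K0 n l) * f y \<partial>(count_space UNIV \<Otimes>\<^sub>M ?R))"
    unfolding inv_measure_def using d f by (rule nn_integral_density)
  also have "\<dots> = (\<integral>\<^sup>+n. (\<integral>\<^sup>+l. inv_density \<alpha> \<beta> A lo G ell K0 n l * f (n, l) \<partial>?R) \<partial>count_space UNIV)"
    using d f by (subst R.nn_integral_fst[symmetric]) simp_all
  also have "\<dots> = (\<Sum>n. \<integral>\<^sup>+l. inv_density \<alpha> \<beta> A lo G ell K0 n l * f (n, l) \<partial>?R)"
    by (rule nn_integral_count_space_nat)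
  also have "\<dots> = (\<Sum>n. ennreal K0 * cycle_law n (occ f))"
    by (simp add: cycle_occ_density[OF K0] nn_integral_restrict_space mult_ac del: inv_density.simps)
  finally show ?thesis by (simp only: ennreal_suminf_cmult)
qed

lemma invariant_inv_measure:
  assumes rec: "AE \<omega> in \<Omega>. reset_time \<alpha> \<beta> A lo ell (0, lo) \<omega> < \<infinity>"
  shows "invariant_measure S (transition \<alpha> \<beta> A lo G ell) \<mu>"
  unfolding invariant_measure_def
proof (intro conjI allI impI ballI)
  show "sets \<mu> = sets S" by (rule sets_inv_measure)
next
  fix t :: real and B assume t: "0 \<le> t" and B[measurable]: "B \<in> sets S"
  have space: "space \<mu> = space S" by (rule sets_eq_imp_space_eq[OF sets_inv_measure])
  have semi: "semi (indicator B) t \<in> borel_measurable S"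
    using semi_measurable[of "indicator B" "\<lambda>_. t" S "\<lambda>x. x"] by simp
  have "(\<integral>\<^sup>+y. emeasure (transition \<alpha> \<beta> A lo G ell t y) B \<partial>\<mu>) = (\<integral>\<^sup>+y. semi (indicator B) t y \<partial>\<mu>)"
    by (intro nn_integral_cong) (simp add: space emeasure_transition t B)
  also have "\<dots> = ennreal K0 * (\<Sum>n. cycle_law n (occ (semi (indicator B) t)))"
    by (rule nn_integral_inv_measure[OF semi])
  also have "\<dots> = ennreal K0 * (\<Sum>n. cycle_law n (occ (indicator B)))"
    by (subst cycle_sum_invariant[OF cycle_1_tendsto[OF rec] t]) (auto simp: indicator_def[abs_def])
  also have "\<dots> = (\<integral>\<^sup>+y. indicator B y \<partial>\<mu>)"
    by (rule nn_integral_inv_measure[symmetric]) measurable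
  also have "\<dots> = emeasure \<mu> B"
    by (rule nn_integral_indicator) (simp add: sets_inv_measure)
  finally show "(\<integral>\<^sup>+y. emeasure (transition \<alpha> \<beta> A lo G ell t y) B \<partial>\<mu>) = emeasure \<mu> B" .
qed

text \<open>The integrand is the intensity times the reset probability, so
  \<open>cycle_occ_density\<close> evaluates summand \<open>n\<close> as \<open>K0\<close> times the
  probability that the cycle ends at jump \<open>n + 1\<close>.\<close>

lemma K0_eq:
  assumes rec: "AE \<omega> in \<Omega>. reset_time \<alpha> \<beta> A lo ell (0, lo) \<omega> < \<infinity>"
  shows "(\<Sum>n. \<integral>\<^sup>+ l. ennreal (l * jump_tail_left G ell (n + 1) (A - l))
     \<partial>inv_slice \<alpha> \<beta> A lo G ell K0 n) = ennreal K0"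
proof -
  let ?r = "\<lambda>y. ennreal (snd y) * reset_prob y"
  have [measurable]: "?r \<in> borel_measurable S"
    using reset_prob_measurable[of "\<lambda>x. x" S] by simp
  have "(\<integral>\<^sup>+ l. ennreal (l * jump_tail_left G ell (n + 1) (A - l)) \<partial>inv_slice \<alpha> \<beta> A lo G ell K0 n) =
     ennreal K0 * cycle_law n reset_step" for n
  proof -
    let ?R = "restrict_space lborel {lo..<A}"
    have r: "ennreal (l * jump_tail_left G ell (n + 1) (A - l)) = ?r (n, l)" if "l \<in> {lo..<A}" for l
      using reset_prob_eq[of "(n, l)"] that by (simp add: space_S)
    have "(\<integral>\<^sup>+ l. ennreal (l * jump_tail_left G ell (n + 1) (A - l)) \<partial>inv_slice \<alpha> \<beta> A lo G ell K0 n) =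
        (\<integral>\<^sup>+ l. ?r (n, l) \<partial>inv_slice \<alpha> \<beta> A lo G ell K0 n)"
      by (intro nn_integral_cong r) (simp add: inv_slice_def space_restrict_space)
    also have "\<dots> = (\<integral>\<^sup>+ l. inv_density \<alpha> \<beta> A lo G ell K0 n l * ?r (n, l) \<partial>?R)"
      unfolding inv_slice_def
    proof (rule nn_integral_density)
      show "inv_density \<alpha> \<beta> A lo G ell K0 n \<in> borel_measurable ?R"
        by (intro measurable_restrict_space1) (simp add: density_measurable[OF K0] del: inv_density.simps)
      have "(\<lambda>l. ?r (n, l) * indicator {lo..<A} l) \<in> borel_measurable lborel"
        by (rule slice_measurable) measurable
      then show "(\<lambda>l. ?r (n, l)) \<in> borel_measurable ?R"
        by (rule borel_measurable_restrict_space_iff_ennreal[THEN iffD2, rotated]) simp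
    qed
    also have "\<dots> = (\<integral>\<^sup>+l\<in>{lo..<A}. ?r (n, l) * inv_density \<alpha> \<beta> A lo G ell K0 n l \<partial>lborel)"
      by (simp add: nn_integral_restrict_space mult_ac del: inv_density.simps)
    also have "\<dots> = ennreal K0 * cycle_law n reset_step"
      unfolding reset_step_def by (rule cycle_occ_density[OF K0, symmetric]) measurable
    finally show ?thesis .
  qed
  then have "(\<Sum>n. \<integral>\<^sup>+ l. ennreal (l * jump_tail_left G ell (n + 1) (A - l)) \<partial>inv_slice \<alpha> \<beta> A lo G ell K0 n) =
     ennreal K0 * (\<Sum>n. cycle_law n reset_step)"
    by (simp only: ennreal_suminf_cmult)
  also have "(\<Sum>n. cycle_law n reset_step) = 1"
    using cycle_reset_tendsto[OF cycle_1_tendsto[OF rec]] by (simp only: sums_def[symmetric] sums_iff)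
  finally show ?thesis by simp
qed

end
end

theorem theorem4p2:
  fixes \<alpha> \<beta> A lo K0 :: real
    and G :: "real measure"
    and ell :: "nat \<Rightarrow> real \<Rightarrow> real"
  assumes "0 < \<alpha>" and "0 < \<beta>" and "\<beta> < A" and "0 < lo" and "lo < \<beta>"
    and "prob_space G"
    and "sets G = sets (restrict_space borel {0..})"
    and "integrable G (\<lambda>z. z\<^sup>2)"
    and "\<And>n z. 1 \<le> n \<Longrightarrow> 0 \<le> z \<Longrightarrow> 0 < ell n z"
    and "\<And>n. 1 \<le> n \<Longrightarrow> mono_on {0..} (ell n)"
    and "\<And>n. 1 \<le> n \<Longrightarrow> continuous_on {0..} (ell n)"
    and "\<And>y. y \<in> space (state_space lo A) \<Longrightarrow>
           AE \<omega> in driving G. reset_time \<alpha> \<beta> A lo ell y \<omega> < \<infinity>"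
    and "0 < K0"
  shows "invariant_measure (state_space lo A) (transition \<alpha> \<beta> A lo G ell)
           (inv_measure \<alpha> \<beta> A lo G ell K0) \<and>
         (\<Sum>n. \<integral>\<^sup>+ l. ennreal (l * jump_tail_left G ell (n + 1) (A - l))
                 \<partial>inv_slice \<alpha> \<beta> A lo G ell K0 n) = ennreal K0"
proof -
  interpret reset_process \<alpha> \<beta> A lo G ell
    by (rule reset_process.intro) (fact assms)+
  have "AE \<omega> in driving G. reset_time \<alpha> \<beta> A lo ell (0, lo) \<omega> < \<infinity>"
    by (rule assms(12)) simp
  with assms(13) show ?thesis
    using invariant_inv_measure K0_eq by blast
qed

end
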